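(* Let $k\ge 1$ be a fixed integer, let $\boldsymbol{\Sigma}$ be a fixed positive definite $k\times k$ covariance matrix, and let $(q_n)$ be a sequence of positive integers with $q_n=o(n)$. Suppose that $\boldsymbol{X}_i\sim N_k(\boldsymbol{\theta}_{0i},\boldsymbol{\Sigma})$ independently for $i=1,\dots,n$. Then, as $n\to\infty$, $$\inf_{\{\widehat{\boldsymbol{\theta}}_i\}}\ \sup_{\{\boldsymbol{\theta}_{0i}\}\in L_0[q_n]}\ \sum_{i=1}^n E_{\boldsymbol{\theta}_{0i}}\lVert\widehat{\boldsymbol{\theta}}_i-\boldsymbol{\theta}_{0i}\rVert_{\Sigma}^2 = 2q_n\log\left(\frac{n}{q_n}\right)(1+o(1)),$$ where the infimum is over all estimators $\{\widehat{\boldsymbol{\theta}}_i\}_{i=1}^n$ of $\{\boldsymbol{\theta}_{0i}\}_{i=1}^n$ based on $\boldsymbol{X}_1,\dots,\boldsymbol{X}_n$.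
   Context: Mahalanobis norm: $\lVert \boldsymbol{x}\rVert_\Sigma^2=\boldsymbol{x}^T\boldsymbol{\Sigma}^{-1}\boldsymbol{x}$ for $\boldsymbol{x}\in\mathbb{R}^k$. Nearly-black multivariate means: $L_0[q_n]=\{\{\boldsymbol{\theta}_{0i}\}_{i=1}^n:\boldsymbol{\theta}_{0i}\in\mathbb{R}^k,\ \sum_{i=1}^n \mathbf{1}(\boldsymbol{\theta}_{0i}\ne\boldsymbol{0})\le q_n\}$. The expectation is with respect to the sampling distribution of the data under the true means $\{\boldsymbol{\theta}_{0i}\}$. *)

theory Defs
  imports "HOL-Probability.Probability" "HOL-Library.Landau_Symbols"
begin

definition pos_def_matrix :: "real ^ 'k ^ 'k \<Rightarrow> bool" where
  "pos_def_matrix S \<longleftrightarrow> transpose S = S \<and> (\<forall>x. x \<noteq> 0 \<longrightarrow> 0 < x \<bullet> (S *v x))"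

definition mahalanobis_sq :: "real ^ 'k ^ 'k \<Rightarrow> real ^ 'k \<Rightarrow> real" where
  "mahalanobis_sq S x = x \<bullet> (matrix_inv S *v x)"

text \<open>The law \<open>N(\<mu>, S)\<close> given by its Lebesgue density; meaningful for positive definite \<open>S\<close>.\<close>
definition mvnormal :: "real ^ 'k \<Rightarrow> real ^ 'k ^ 'k \<Rightarrow> (real ^ 'k) measure" where
  "mvnormal \<mu> S = density lborel
     (\<lambda>x. ennreal (exp (- mahalanobis_sq S (x - \<mu>) / 2) / sqrt ((2 * pi) ^ CARD('k) * det S)))"

text \<open>Families indexed by \<open>{1..n}\<close> are extensional functions on \<open>nat\<close>, the points of the
  product spaces over \<open>{1..n}\<close>.\<close>
definition nearly_black :: "nat \<Rightarrow> nat \<Rightarrow> (nat \<Rightarrow> real ^ 'k) set" where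
  "nearly_black n q =
     {\<theta> \<in> {1..n} \<rightarrow>\<^sub>E UNIV. (\<Sum>i = 1..n. of_bool (\<theta> i \<noteq> 0) :: nat) \<le> q}"

definition sampling_dist :: "nat \<Rightarrow> real ^ 'k ^ 'k \<Rightarrow> (nat \<Rightarrow> real ^ 'k) \<Rightarrow> (nat \<Rightarrow> real ^ 'k) measure"
  where "sampling_dist n S \<theta> = PiM {1..n} (\<lambda>i. mvnormal (\<theta> i) S)"

definition estimators :: "nat \<Rightarrow> ((nat \<Rightarrow> real ^ 'k) \<Rightarrow> nat \<Rightarrow> real ^ 'k) set" where
  "estimators n = PiM {1..n} (\<lambda>_. borel) \<rightarrow>\<^sub>M PiM {1..n} (\<lambda>_. borel)"

text \<open>Risks are \<open>ennreal\<close>-valued because an arbitrary estimator may have infinite risk.\<close>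
definition risk ::
  "nat \<Rightarrow> real ^ 'k ^ 'k \<Rightarrow> ((nat \<Rightarrow> real ^ 'k) \<Rightarrow> nat \<Rightarrow> real ^ 'k) \<Rightarrow> (nat \<Rightarrow> real ^ 'k) \<Rightarrow> ennreal"
  where "risk n S T \<theta> =
    (\<Sum>i = 1..n. \<integral>\<^sup>+ x. ennreal (mahalanobis_sq S (T x i - \<theta> i)) \<partial>sampling_dist n S \<theta>)"

definition minimax_risk :: "nat \<Rightarrow> nat \<Rightarrow> real ^ 'k ^ 'k \<Rightarrow> ennreal" where
  "minimax_risk n q S = (INF T\<in>estimators n. SUP \<theta>\<in>nearly_black n q. risk n S T \<theta>)"

end

theory Submission
  imports Defs "HOL-Real_Asymp.Real_Asymp"
begin

text \<open>
  Write \<open>Q\<close> for the squared Mahalanobis norm, \<open>L = ln (n / q)\<close>, and call a nonzero mean a spike.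

  The upper bound comes from keeping an observation when its \<open>Q\<close>-value reaches a threshold
  \<open>\<tau> = 2 (1 + d) L\<close> and replacing it by zero otherwise.  At a zero mean the risk is a truncated
  second moment, which an exponential moment bounds by a constant times \<open>q / n\<close>; over all \<open>n\<close>
  coordinates this adds up to \<open>O(q)\<close>.  At a spike the loss never exceeds
  \<open>(1 + d) \<tau> + (1 + 1/d) Q (noise)\<close>, so the at most \<open>q\<close> spikes cost
  \<open>2 q L (1 + d)\<^sup>2 + O(q)\<close> (\<open>minimax_risk_upper\<close>).  As \<open>L\<close> diverges, \<open>d\<close> can be taken arbitrarily small.

  The lower bound is Bayesian.  Split \<open>q m\<close> of the coordinates into \<open>q\<close> blocks of size
  \<open>m = n div q\<close> and put into each block, independently, one spike of squared norm
  \<open>a\<^sup>2 = 2 (1 - \<eta>) ln m\<close> in a fixed direction \<open>e\<close>, at a uniformly random position.  Given the data, the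
  best estimate of the coordinates of a block is governed by the posterior probabilities of the
  positions, and its risk is \<open>a\<^sup>2\<close> times the expected posterior mass off the true position
  (\<open>block_risk_ge_posterior\<close>).  The spike moves the \<open>e\<close>-component of its observation to \<open>a + O(1)\<close>, whereas
  the largest of \<open>m - 1\<close> pure noise components is about \<open>sqrt (2 ln m)\<close>, which exceeds \<open>a\<close> by more
  than any constant.  With probability near one some noise coordinate therefore beats the spike by a
  margin of at least 1, its likelihood ratio is larger by a factor of at least \<open>exp a\<close>, and the
  true position has negligible posterior mass (\<open>posterior_spread\<close>).  A block costs \<open>a\<^sup>2 (1 - O(\<eta>))\<close>, the
  \<open>q\<close> blocks cost \<open>2 q ln m (1 - O(\<eta>))\<close>, and \<open>ln m\<close> is asymptotic to \<open>L\<close>.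

  Few facts about the Gaussian law are used: total mass one, finite exponential moments of \<open>Q\<close> below
  the critical order, and a lower tail bound obtained by tilting.  Total mass one rests on the change
  of variables formula for invertible matrices over an arbitrary finite index type.
\<close>


section \<open>Linear change of variables for Lebesgue measure\<close>

lemma nn_integral_lborel_translate:
  fixes c :: "'a::euclidean_space"
  assumes [measurable]: "f \<in> borel_measurable borel"
  shows "(\<integral>\<^sup>+x. f (x + c) \<partial>lborel) = (\<integral>\<^sup>+x. f x \<partial>lborel)"
proof -
  have "(\<integral>\<^sup>+x. f x \<partial>lborel) = (\<integral>\<^sup>+x. f x \<partial>distr lborel borel ((+) c))"
    by (simp add: lborel_distr_plus)
  then show ?thesis
    by (simp add: nn_integral_distr add.commute)
qed

lemma nn_integral_lborel_reflect:
  fixes f :: "'a::euclidean_space \<Rightarrow> ennreal"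
  assumes [measurable]: "f \<in> borel_measurable borel"
  shows "(\<integral>\<^sup>+x. f (- x) \<partial>lborel) = (\<integral>\<^sup>+x. f x \<partial>lborel)"
proof -
  have "lborel = distr lborel borel (\<lambda>x::'a. - x)"
    using lborel_affine[of "-1" "0::'a"] by (simp add: density_1)
  then have "(\<integral>\<^sup>+x. f x \<partial>lborel) = (\<integral>\<^sup>+x. f x \<partial>distr lborel borel (\<lambda>x. - x))"
    by simp
  then show ?thesis
    by (simp add: nn_integral_distr)
qed

text \<open>
  Up to a constant factor there is only one translation-invariant integral.  In the double integral of
  \<open>f (T x) g (y + T x)\<close>, shifting \<open>y\<close> separates the variables one way and shifting \<open>x\<close> separates
  them the other way; so \<open>f \<mapsto> \<integral> f (T x) dx\<close> is proportional to the Lebesgue integral, here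
  expressed without naming the constant.
\<close>
lemma nn_integral_linear_exchange:
  fixes T U :: "'a::euclidean_space \<Rightarrow> 'a"
  assumes T: "linear T" and U: "linear U" and TU: "\<And>x. T (U x) = x"
    and [measurable]: "f \<in> borel_measurable borel" "g \<in> borel_measurable borel"
  shows "(\<integral>\<^sup>+x. f (T x) \<partial>lborel) * (\<integral>\<^sup>+x. g x \<partial>lborel) = (\<integral>\<^sup>+x. g (T x) \<partial>lborel) * (\<integral>\<^sup>+x. f x \<partial>lborel)"
proof -
  have [measurable]: "T \<in> borel_measurable borel"
    using T by (intro borel_measurable_continuous_onI linear_continuous_on) (simp add: linear_conv_bounded_linear)
  have "(\<integral>\<^sup>+x. f (T x) \<partial>lborel) * (\<integral>\<^sup>+x. g x \<partial>lborel)
    = (\<integral>\<^sup>+x. f (T x) * (\<integral>\<^sup>+y. g y \<partial>lborel) \<partial>lborel)"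
    by (simp add: nn_integral_multc)
  also have "\<dots> = (\<integral>\<^sup>+x. f (T x) * (\<integral>\<^sup>+y. g (y + T x) \<partial>lborel) \<partial>lborel)"
    by (simp add: nn_integral_lborel_translate)
  also have "\<dots> = (\<integral>\<^sup>+x. (\<integral>\<^sup>+y. f (T x) * g (y + T x) \<partial>lborel) \<partial>lborel)"
    by (simp add: nn_integral_cmult)
  also have "\<dots> = (\<integral>\<^sup>+y. (\<integral>\<^sup>+x. f (T x) * g (y + T x) \<partial>lborel) \<partial>lborel)"
    by (rule lborel_pair.Fubini') measurable
  also have "\<dots> = (\<integral>\<^sup>+y. (\<integral>\<^sup>+x. f (T x - y) * g (T x) \<partial>lborel) \<partial>lborel)"
  proof (rule nn_integral_cong)
    fix y
    have "(\<integral>\<^sup>+x. f (T x) * g (y + T x) \<partial>lborel) = (\<integral>\<^sup>+x. f (T (x + - U y)) * g (y + T (x + - U y)) \<partial>lborel)"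
      by (rule nn_integral_lborel_translate[symmetric]) measurable
    also have "\<dots> = (\<integral>\<^sup>+x. f (T x - y) * g (T x) \<partial>lborel)"
      using T TU by (simp add: linear_diff)
    finally show "(\<integral>\<^sup>+x. f (T x) * g (y + T x) \<partial>lborel) = (\<integral>\<^sup>+x. f (T x - y) * g (T x) \<partial>lborel)" .
  qed
  also have "\<dots> = (\<integral>\<^sup>+x. (\<integral>\<^sup>+y. f (T x - y) * g (T x) \<partial>lborel) \<partial>lborel)"
    by (rule lborel_pair.Fubini'[symmetric]) measurable
  also have "\<dots> = (\<integral>\<^sup>+x. (\<integral>\<^sup>+y. f y \<partial>lborel) * g (T x) \<partial>lborel)"
  proof (rule nn_integral_cong)
    fix x
    have "(\<integral>\<^sup>+y. f (T x - y) \<partial>lborel) = (\<integral>\<^sup>+y. f (T x - (- y)) \<partial>lborel)"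
      by (rule nn_integral_lborel_reflect[symmetric]) measurable
    also have "\<dots> = (\<integral>\<^sup>+y. f (y + T x) \<partial>lborel)" by (simp add: add.commute)
    also have "\<dots> = (\<integral>\<^sup>+y. f y \<partial>lborel)" by (rule nn_integral_lborel_translate) measurable
    finally show "(\<integral>\<^sup>+y. f (T x - y) * g (T x) \<partial>lborel) = (\<integral>\<^sup>+y. f y \<partial>lborel) * g (T x)"
      by (subst nn_integral_multc) auto
  qed
  also have "\<dots> = (\<integral>\<^sup>+x. g (T x) \<partial>lborel) * (\<integral>\<^sup>+x. f x \<partial>lborel)"
    by (simp add: nn_integral_cmult mult.commute)
  finally show ?thesis .
qed

lemma ennreal_square_cancel: "a * a = b * b \<Longrightarrow> a = (b::ennreal)"
  by (cases a; cases b) (auto simp: ennreal_mult'[symmetric] ennreal_top_mult square_eq_iff)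

text \<open>
  The determinant condition is part of the predicate so that it is closed under products and holds
  for every matrix: a product is invertible exactly if both factors are, and singular matrices
  satisfy it trivially.
\<close>
definition scales_lborel :: "real^'k^'k \<Rightarrow> bool" where
  "scales_lborel A \<longleftrightarrow> (det A \<noteq> 0 \<longrightarrow> (\<forall>f \<in> borel_measurable borel.
     (\<integral>\<^sup>+x. f x \<partial>lborel) = ennreal \<bar>det A\<bar> * (\<integral>\<^sup>+x. f (A *v x) \<partial>lborel)))"

lemma measurable_matrix_vector_mult [measurable]:
  "(\<lambda>x. (A::real^'k^'m) *v x) \<in> borel_measurable borel"
  by (intro borel_measurable_continuous_onI) (simp add: linear_continuous_on)

text \<open>
  For an involution, \<open>nn_integral_linear_exchange\<close> with \<open>g = f \<circ> A\<close> says that the integrals of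
  \<open>f\<close> and of \<open>f \<circ> A\<close> have equal squares.
\<close>
lemma scales_lborel_involution:
  fixes A :: "real^'k^'k"
  assumes "A ** A = mat 1"
  shows "scales_lborel A"
  unfolding scales_lborel_def
proof (intro impI ballI)
  fix f :: "real^'k \<Rightarrow> ennreal" assume f[measurable]: "f \<in> borel_measurable borel"
  have A: "A *v (A *v x) = x" for x
    by (simp add: assms matrix_vector_mul_assoc)
  have "det A * det A = 1"
    by (metis assms det_I det_mul)
  then have "\<bar>det A\<bar> = 1"
    by (metis abs_1 abs_mult abs_mult_self_eq abs_of_nonneg abs_square_eq_1 power2_eq_square)
  moreover have "(\<integral>\<^sup>+x. f (A *v x) \<partial>lborel) = (\<integral>\<^sup>+x. f x \<partial>lborel)"
  proof (rule ennreal_square_cancel)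
    have "(\<integral>\<^sup>+x. f (A *v x) \<partial>lborel) * (\<integral>\<^sup>+x. f (A *v x) \<partial>lborel)
      = (\<integral>\<^sup>+x. f (A *v (A *v x)) \<partial>lborel) * (\<integral>\<^sup>+x. f x \<partial>lborel)"
      by (rule nn_integral_linear_exchange[where U="(*v) A"]) (auto simp: A)
    then show "(\<integral>\<^sup>+x. f (A *v x) \<partial>lborel) * (\<integral>\<^sup>+x. f (A *v x) \<partial>lborel)
      = (\<integral>\<^sup>+x. f x \<partial>lborel) * (\<integral>\<^sup>+x. f x \<partial>lborel)" by (simp add: A)
  qed
  ultimately show "(\<integral>\<^sup>+x. f x \<partial>lborel) = ennreal \<bar>det A\<bar> * (\<integral>\<^sup>+x. f (A *v x) \<partial>lborel)"
    by simp
qed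

lemma scales_lborel_mult:
  fixes A B :: "real^'k^'k"
  assumes A: "scales_lborel A" and B: "scales_lborel B"
  shows "scales_lborel (A ** B)"
  unfolding scales_lborel_def
proof (intro impI ballI)
  fix f :: "real^'k \<Rightarrow> ennreal" assume f[measurable]: "f \<in> borel_measurable borel"
  assume "det (A ** B) \<noteq> 0"
  then have dA: "det A \<noteq> 0" and dB: "det B \<noteq> 0" by (auto simp: det_mul)
  have "(\<integral>\<^sup>+x. f x \<partial>lborel) = ennreal \<bar>det A\<bar> * (\<integral>\<^sup>+x. f (A *v x) \<partial>lborel)"
    using A dA f unfolding scales_lborel_def by blast
  also have "(\<integral>\<^sup>+x. f (A *v x) \<partial>lborel) = ennreal \<bar>det B\<bar> * (\<integral>\<^sup>+x. f (A *v (B *v x)) \<partial>lborel)"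
  proof -
    have "(\<lambda>x. f (A *v x)) \<in> borel_measurable borel" by measurable
    then show ?thesis using B dB unfolding scales_lborel_def by blast
  qed
  finally show "(\<integral>\<^sup>+x. f x \<partial>lborel) = ennreal \<bar>det (A ** B)\<bar> * (\<integral>\<^sup>+x. f ((A ** B) *v x) \<partial>lborel)"
    by (simp add: det_mul abs_mult ennreal_mult' mult.assoc matrix_vector_mul_assoc)
qed

lemma scales_lborel_diagonal:
  fixes A :: "real^'k^'k"
  assumes A: "\<And>i j. i \<noteq> j \<Longrightarrow> A$i$j = 0"
  shows "scales_lborel A"
  unfolding scales_lborel_def
proof (intro impI ballI)
  fix f :: "real^'k \<Rightarrow> ennreal" assume f[measurable]: "f \<in> borel_measurable borel"
  assume "det A \<noteq> 0"
  moreover have det: "det A = (\<Prod>i\<in>UNIV. A$i$i)"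
    by (rule det_diagonal) (use A in auto)
  ultimately have nz: "A$i$i \<noteq> 0" for i by auto
  define c :: "real^'k \<Rightarrow> real" where "c b = A $ (axis_index b) $ (axis_index b)" for b
  have Basis: "Basis = range (\<lambda>i::'k. axis i (1::real))" by (auto simp: Basis_vec_def)
  have inj: "inj (\<lambda>i::'k. axis i (1::real))" by (auto simp: inj_on_def axis_eq_axis)
  have T: "0 + (\<Sum>j\<in>Basis. (c j * (x \<bullet> j)) *\<^sub>R j) = A *v x" for x
  proof -
    have "(\<Sum>j\<in>Basis. (c j * (x \<bullet> j)) *\<^sub>R j) = (\<Sum>i\<in>UNIV. (A$i$i * x$i) *\<^sub>R axis i 1)"
      unfolding Basis by (subst sum.reindex[OF inj]) (simp add: c_def inner_axis)
    also have "\<dots> = A *v x"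
    proof (subst vec_eq_iff, rule allI)
      fix i
      have "(A *v x) $ i = (\<Sum>j\<in>UNIV. if j = i then A$i$i * x$i else 0)"
        unfolding matrix_vector_mult_def vec_lambda_beta by (rule sum.cong) (auto simp: A)
      moreover have "(\<Sum>j\<in>UNIV. (A$j$j * x$j) *\<^sub>R axis j 1) $ i = (\<Sum>j\<in>UNIV. if j = i then A$i$i * x$i else 0)"
        unfolding sum_component by (rule sum.cong) (auto simp: axis_def)
      ultimately show "(\<Sum>j\<in>UNIV. (A$j$j * x$j) *\<^sub>R axis j 1) $ i = (A *v x) $ i" by simp
    qed
    finally show ?thesis by simp
  qed
  have "(\<Prod>j\<in>Basis. \<bar>c j\<bar>) = \<bar>det A\<bar>"
    unfolding Basis by (subst prod.reindex[OF inj]) (simp add: c_def axis_index_axis det abs_prod)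
  then have "lborel = density (distr lborel borel (\<lambda>x. A *v x)) (\<lambda>_. ennreal \<bar>det A\<bar>)"
    using lborel_affine_euclidean[of c 0] nz unfolding T c_def[symmetric]
    by (auto simp: c_def)
  then have "(\<integral>\<^sup>+x. f x \<partial>lborel) = (\<integral>\<^sup>+x. f x \<partial>density (distr lborel borel (\<lambda>x. A *v x)) (\<lambda>_. ennreal \<bar>det A\<bar>))"
    by simp
  then show "(\<integral>\<^sup>+x. f x \<partial>lborel) = ennreal \<bar>det A\<bar> * (\<integral>\<^sup>+x. f (A *v x) \<partial>lborel)"
    by (simp add: nn_integral_density nn_integral_distr nn_integral_cmult)
qed

lemma sum_UNIV_of_bool_mult:
  fixes x :: "'k::finite \<Rightarrow> real"
  shows "(\<Sum>j\<in>UNIV. of_bool (j = i) * x j) = x i"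
  by (simp_all add: of_bool_def if_distrib[of "\<lambda>z. z * _"] cong: if_cong)

text \<open>
  Every matrix is a product of diagonal matrices, transpositions, shears and matrices with a zero row.
  Transpositions are involutions, and a shear \<open>E\<close> of coordinate \<open>m\<close> is the product of the two
  involutions \<open>D\<close> and \<open>D E\<close>, where \<open>D\<close> flips the sign of coordinate \<open>m\<close>.
\<close>
proposition scales_lborel: "scales_lborel (A :: real^'k^'k)"
proof (rule induct_matrix_elementary_alt[of scales_lborel])
  show "scales_lborel (A ** B)" if "scales_lborel A" "scales_lborel B" for A B :: "real^'k^'k"
    using that by (rule scales_lborel_mult)
  show "scales_lborel A" if "row i A = 0" for A :: "real^'k^'k" and i
    using that det_zero_row(1)[of i A] by (simp add: scales_lborel_def)
  show "scales_lborel A" if "\<And>i j. i \<noteq> j \<Longrightarrow> A$i$j = 0" for A :: "real^'k^'k"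
    using that by (rule scales_lborel_diagonal)
  fix m n :: 'k assume mn: "m \<noteq> n"
  show "scales_lborel (\<chi> i j. mat 1 $ i $ Transposition.transpose m n j :: real^'k^'k)"
  proof (rule scales_lborel_involution)
    let ?P = "\<chi> i j. mat 1 $ i $ Transposition.transpose m n j :: real^'k^'k"
    have "(?P *v x) $ i = x $ Transposition.transpose m n i" for x i
    proof -
      have "(?P *v x) $ i = (\<Sum>j\<in>UNIV. of_bool (j = Transposition.transpose m n i) * x $ j)"
        unfolding matrix_vector_mult_def vec_lambda_beta
        by (rule sum.cong) (auto simp: mat_def)
      then show ?thesis by (simp only: sum_UNIV_of_bool_mult)
    qed
    then show "?P ** ?P = mat 1"
      by (simp add: matrix_eq vec_eq_iff matrix_vector_mul_assoc[symmetric])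
  qed
  define D :: "real^'k^'k" where "D = (\<chi> i j. if i = j then (if i = m then -1 else 1) else 0)"
  define E :: "real^'k^'k" where "E = (\<chi> i j. of_bool (i = m \<and> j = n \<or> i = j))"
  have Dv: "(D *v x) $ i = (if i = m then - x $ m else x $ i)" for x i
  proof -
    have "(D *v x) $ i = (\<Sum>j\<in>UNIV. of_bool (j = i) * ((if i = m then -1 else 1) * x $ j))"
      unfolding matrix_vector_mult_def vec_lambda_beta by (rule sum.cong) (auto simp: D_def)
    then show ?thesis by (simp add: sum_UNIV_of_bool_mult)
  qed
  have Ev: "(E *v x) $ i = (if i = m then x $ m + x $ n else x $ i)" for x i
  proof -
    have "(E *v x) $ i = (\<Sum>j\<in>UNIV. of_bool (j = i) * x $ j + (if i = m then of_bool (j = n) * x $ j else 0))"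
      unfolding matrix_vector_mult_def vec_lambda_beta using mn by (intro sum.cong) (auto simp: E_def)
    then show ?thesis by (simp add: sum.distrib sum_UNIV_of_bool_mult)
  qed
  have D: "D ** D = mat 1"
    by (auto simp: matrix_eq vec_eq_iff Dv matrix_vector_mul_assoc[symmetric])
  have DE: "(D ** E) ** (D ** E) = mat 1"
    using mn by (auto simp: matrix_eq vec_eq_iff Dv Ev matrix_vector_mul_assoc[symmetric])
  have "E = D ** (D ** E)"
    by (simp add: matrix_mul_assoc D)
  then show "scales_lborel (\<chi> i j. of_bool (i = m \<and> j = n \<or> i = j) :: real^'k^'k)"
    unfolding E_def[symmetric]
    by (metis D DE scales_lborel_involution scales_lborel_mult)
qed

section \<open>Positive definite matrices and the standard Gaussian integral\<close>

lemma inner_matrix_vector_transpose: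
  fixes A :: "real^'n^'m"
  shows "x \<bullet> (A *v y) = (transpose A *v x) \<bullet> y"
  by (metis dot_lmul_matrix transpose_matrix_vector)

lemma pos_def_matrix_inverse:
  fixes S :: "real^'k^'k"
  assumes "pos_def_matrix S"
  shows "S ** matrix_inv S = mat 1" "matrix_inv S ** S = mat 1"
proof -
  have "S *v x = 0 \<longrightarrow> x = 0" for x
    using assms unfolding pos_def_matrix_def by (metis inner_zero_right less_irrefl)
  then have "invertible S"
    by (simp add: invertible_left_inverse matrix_left_invertible_ker)
  then have "S ** matrix_inv S = mat 1 \<and> matrix_inv S ** S = mat 1"
    unfolding invertible_def matrix_inv_def by (rule someI_ex)
  then show "S ** matrix_inv S = mat 1" "matrix_inv S ** S = mat 1" by auto
qed

lemma pos_def_matrix_matrix_inv: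
  fixes S :: "real^'k^'k"
  assumes S: "pos_def_matrix S"
  shows "pos_def_matrix (matrix_inv S)"
proof -
  let ?B = "matrix_inv S"
  note inv = pos_def_matrix_inverse[OF S]
  have "transpose ?B ** S = mat 1"
    using inv(1) S unfolding pos_def_matrix_def by (metis matrix_transpose_mul transpose_mat)
  then have t: "transpose ?B = ?B"
    by (metis inv(1) matrix_mul_assoc matrix_mul_lid matrix_mul_rid)
  have "0 < x \<bullet> (?B *v x)" if "x \<noteq> 0" for x
  proof -
    have x: "x = S *v (?B *v x)" by (simp add: matrix_vector_mul_assoc inv)
    then have "?B *v x \<noteq> 0" using that by (metis matrix_vector_mult_0_right)
    then have "0 < (?B *v x) \<bullet> (S *v (?B *v x))" using S unfolding pos_def_matrix_def by blast
    then show ?thesis using x by (simp add: inner_commute)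
  qed
  with t show ?thesis unfolding pos_def_matrix_def by blast
qed

text \<open>
  The columns of \<open>A\<close> are a basis that is orthonormal for the form \<open>B\<close>, built one vector at a time: as
  long as there are fewer vectors \<open>v\<close> than dimensions, some nonzero \<open>x\<close> is orthogonal to all \<open>B v\<close>.
\<close>
lemma pos_def_matrix_congruent_identity:
  fixes B :: "real^'k^'k"
  assumes B: "pos_def_matrix B"
  shows "\<exists>A::real^'k^'k. transpose A ** (B ** A) = mat 1"
proof -
  have sym: "x \<bullet> (B *v y) = y \<bullet> (B *v x)" for x y
    using B unfolding pos_def_matrix_def by (metis inner_commute inner_matrix_vector_transpose)
  have "\<exists>V. finite V \<and> card V = n \<and> (\<forall>u\<in>V. \<forall>v\<in>V. u \<bullet> (B *v v) = of_bool (u = v))"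
    if "n \<le> CARD('k)" for n
    using that
  proof (induction n)
    case 0
    show ?case by (rule exI[of _ "{}"]) auto
  next
    case (Suc n)
    then obtain V where V: "finite V" "card V = n" "\<And>u v. u \<in> V \<Longrightarrow> v \<in> V \<Longrightarrow> u \<bullet> (B *v v) = of_bool (u = v)"
      by (metis Suc_leD)
    have "dim ((*v) B ` V) \<le> card ((*v) B ` V)" by (rule dim_le_card') (use V in auto)
    also have "\<dots> \<le> n" using V card_image_le by blast
    finally have "dim ((*v) B ` V) < DIM(real^'k)" using Suc.prems by simp
    then obtain x where x: "x \<noteq> 0" "\<And>y. y \<in> span ((*v) B ` V) \<Longrightarrow> orthogonal x y"
      using orthogonal_to_subspace_exists by blast
    have xv: "x \<bullet> (B *v v) = 0" if "v \<in> V" for v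
      using x(2)[of "B *v v"] that by (auto simp: orthogonal_def span_base)
    define r where "r = x \<bullet> (B *v x)"
    have r: "r > 0" using B x(1) unfolding pos_def_matrix_def r_def by blast
    define u where "u = (1 / sqrt r) *\<^sub>R x"
    have uu: "u \<bullet> (B *v u) = 1"
      using r by (simp add: u_def matrix_vector_mult_scaleR r_def[symmetric] field_simps)
    have uv: "u \<bullet> (B *v v) = 0" if "v \<in> V" for v
      using xv[OF that] by (simp add: u_def)
    have "u \<notin> V" using uu uv by force
    then show ?case
      using V uu uv sym by (intro exI[of _ "insert u V"]) (auto simp: )
  qed
  from this[OF order_refl] obtain V where V: "finite V" "card V = CARD('k)"
    "\<And>u v. u \<in> V \<Longrightarrow> v \<in> V \<Longrightarrow> u \<bullet> (B *v v) = of_bool (u = v)" by blast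
  then obtain h where h: "bij_betw h (UNIV::'k set) V"
    using finite_same_card_bij[of "UNIV::'k set" V] by auto
  define A :: "real^'k^'k" where "A = (\<chi> i j. h j $ i)"
  have A_nth: "A $ i $ j = h j $ i" for i j by (simp add: A_def)
  have BA: "(B ** A) $ i $ j = (B *v h j) $ i" for i j
    by (simp add: A_def matrix_matrix_mult_def matrix_vector_mult_def)
  have "(transpose A ** (B ** A)) $ i $ j = h i \<bullet> (B *v h j)" for i j
    unfolding matrix_matrix_mult_def[of "transpose A"] by (simp add: BA transpose_def A_nth inner_vec_def)
  moreover have "h i \<bullet> (B *v h j) = of_bool (i = j)" for i j
    using V(3)[of "h i" "h j"] h by (auto simp: bij_betw_def inj_on_def)
  ultimately have "transpose A ** (B ** A) = mat 1"
    by (simp add: vec_eq_iff mat_def)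
  then show ?thesis by blast
qed

lemma nn_integral_standard_gaussian_real: "(\<integral>\<^sup>+t. ennreal (exp (- (t\<^sup>2 / 2))) \<partial>lborel) = ennreal (sqrt (2 * pi))"
proof -
  have "(\<integral>\<^sup>+t. ennreal (exp (- (t\<^sup>2 / 2))) \<partial>lborel) = (\<integral>\<^sup>+t. ennreal (sqrt (2 * pi)) * ennreal (normal_density 0 1 t) \<partial>lborel)"
    by (intro nn_integral_cong) (simp add: normal_density_def ennreal_mult'[symmetric])
  also have "\<dots> = ennreal (sqrt (2 * pi)) * (\<integral>\<^sup>+t. ennreal (normal_density 0 1 t) \<partial>lborel)"
    by (simp add: nn_integral_cmult)
  also have "(\<integral>\<^sup>+t. ennreal (normal_density 0 1 t) \<partial>lborel) = 1"
    using prob_space.emeasure_space_1[OF prob_space_normal_density[of 1 0]] by (simp add: emeasure_density)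
  finally show ?thesis by simp
qed

lemma nn_integral_standard_gaussian:
  "(\<integral>\<^sup>+x. ennreal (exp (- ((x::'a::euclidean_space) \<bullet> x / 2))) \<partial>lborel) = ennreal (sqrt ((2 * pi) ^ DIM('a)))"
proof -
  have "(\<integral>\<^sup>+x. ennreal (exp (- ((x::'a) \<bullet> x / 2))) \<partial>lborel)
    = (\<integral>\<^sup>+x. (\<Prod>b\<in>Basis. ennreal (exp (- (((x::'a) \<bullet> b)\<^sup>2 / 2)))) \<partial>lborel)"
  proof (rule nn_integral_cong)
    fix x :: 'a
    have "x \<bullet> x = (\<Sum>b\<in>Basis. (x \<bullet> b)\<^sup>2)"
      by (subst euclidean_inner) (simp add: power2_eq_square)
    then have "exp (- (x \<bullet> x / 2)) = exp (\<Sum>b\<in>Basis. - ((x \<bullet> b)\<^sup>2 / 2))"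
      by (simp add: sum_negf sum_divide_distrib)
    also have "\<dots> = (\<Prod>b\<in>Basis. exp (- ((x \<bullet> b)\<^sup>2 / 2)))"
      by (rule exp_sum) simp
    finally show "ennreal (exp (- (x \<bullet> x / 2))) = (\<Prod>b\<in>Basis. ennreal (exp (- ((x \<bullet> b)\<^sup>2 / 2))))"
      by (simp add: prod_ennreal)
  qed
  also have "\<dots> = (\<Prod>b\<in>(Basis::'a set). ennreal (sqrt (2 * pi)))"
    by (subst nn_integral_lborel_prod) (simp_all add: nn_integral_standard_gaussian_real)
  finally show ?thesis by (simp add: ennreal_power real_sqrt_mult real_sqrt_power power_mult_distrib)
qed

section \<open>The normal law and its Mahalanobis form\<close>

text \<open>
  The locale fixes the covariance matrix, so that the inner product, the norm and the normal laws it
  determines can be written without it.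
\<close>
locale covariance =
  fixes S :: "real^'k^'k"
  assumes pos_def: "pos_def_matrix S"
begin

definition ip :: "real^'k \<Rightarrow> real^'k \<Rightarrow> real" where "ip x y = x \<bullet> (matrix_inv S *v y)"

abbreviation Q :: "real^'k \<Rightarrow> real" where "Q \<equiv> mahalanobis_sq S"

abbreviation N :: "real^'k \<Rightarrow> (real^'k) measure" where "N \<theta> \<equiv> mvnormal \<theta> S"

lemma Q_ip: "Q x = ip x x" by (simp add: mahalanobis_sq_def ip_def)

lemma ip_commute: "ip x y = ip y x"
  using pos_def_matrix_matrix_inv[OF pos_def] unfolding pos_def_matrix_def ip_def
  by (metis inner_commute inner_matrix_vector_transpose)

lemma ip_linear:
  "ip (x + y) z = ip x z + ip y z" "ip x (y + z) = ip x y + ip x z"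
  "ip (x - y) z = ip x z - ip y z" "ip x (y - z) = ip x y - ip x z"
  "ip (c *\<^sub>R x) z = c * ip x z" "ip x (c *\<^sub>R z) = c * ip x z" "ip 0 z = 0"
  by (simp_all add: ip_def inner_simps matrix_vector_right_distrib matrix_vector_mult_diff_distrib matrix_vector_mult_scaleR)

lemma Q_pos: "x \<noteq> 0 \<Longrightarrow> Q x > 0"
  using pos_def_matrix_matrix_inv[OF pos_def] unfolding pos_def_matrix_def mahalanobis_sq_def by blast

lemma Q_0 [simp]: "Q 0 = 0" by (simp add: Q_ip ip_linear)

lemma Q_nonneg [simp]: "Q x \<ge> 0"
  by (cases "x = 0") (auto intro: less_imp_le Q_pos)

lemma Q_scaleR: "Q (c *\<^sub>R x) = c\<^sup>2 * Q x"
  by (simp add: Q_ip ip_linear power2_eq_square)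

lemma Q_minus [simp]: "Q (- x) = Q x"
  using Q_scaleR[of "-1" x] by simp

lemma measurable_ip [measurable]: "(\<lambda>x. ip e x) \<in> borel_measurable borel"
  unfolding ip_def by measurable

lemma measurable_Q [measurable]: "Q \<in> borel_measurable borel"
  unfolding mahalanobis_sq_def by measurable

text \<open>
  The weighted form of the triangle inequality, from \<open>2 ip x y \<le> d Q x + Q y / d\<close>.  A small \<open>d\<close>
  keeps the constant in front of \<open>Q x\<close> close to 1.
\<close>
lemma Q_add_le:
  assumes "d > 0"
  shows "Q (x + y) \<le> (1 + d) * Q x + (1 + 1 / d) * Q y"
proof -
  have "0 \<le> Q (sqrt d *\<^sub>R x - (1 / sqrt d) *\<^sub>R y)" by simp
  also have "\<dots> = d * Q x + Q y / d - 2 * ip x y"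
    using assms by (simp add: Q_ip ip_linear ip_commute[of y x] real_sqrt_divide algebra_simps flip: power2_eq_square)
  finally show ?thesis
    by (simp add: Q_ip ip_linear ip_commute[of y x] algebra_simps)
qed

text \<open>
  In coordinates for which \<open>Q\<close> is the standard squared norm the integral becomes the standard
  Gaussian one; the Jacobian \<open>\<bar>det A\<bar>\<close> of this substitution is the square root of \<open>det S\<close>.
\<close>
lemma det_pos: "det S > 0" and nn_integral_exp_Q:
  "(\<integral>\<^sup>+x. ennreal (exp (- (Q x / 2))) \<partial>lborel) = ennreal (sqrt ((2 * pi) ^ CARD('k) * det S))"
proof -
  obtain A :: "real^'k^'k" where A: "transpose A ** (matrix_inv S ** A) = mat 1"
    using pos_def_matrix_congruent_identity[OF pos_def_matrix_matrix_inv[OF pos_def]] by blast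
  have "det A * (det (matrix_inv S) * det A) = 1"
    using arg_cong[OF A, of det] by (simp add: det_mul)
  moreover have "det S * det (matrix_inv S) = 1"
    using arg_cong[OF pos_def_matrix_inverse(1)[OF pos_def], of det] by (simp add: det_mul)
  ultimately have det: "det S = (det A)\<^sup>2" "det A \<noteq> 0"
    by (auto simp: power2_eq_square) (metis mult.assoc mult.commute mult.right_neutral)
  then show "det S > 0" by simp
  have QA: "Q (A *v x) = x \<bullet> x" for x
  proof -
    have "Q (A *v x) = (matrix_inv S *v (A *v x)) \<bullet> (A *v x)"
      by (simp add: mahalanobis_sq_def inner_commute)
    also have "\<dots> = (transpose A *v (matrix_inv S *v (A *v x))) \<bullet> x"
      by (rule inner_matrix_vector_transpose)
    also have "transpose A *v (matrix_inv S *v (A *v x)) = x"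
      by (simp add: matrix_vector_mul_assoc matrix_mul_assoc[symmetric] A)
    finally show ?thesis .
  qed
  have "(\<lambda>x. ennreal (exp (- (Q x / 2)))) \<in> borel_measurable borel" by measurable
  then have "(\<integral>\<^sup>+x. ennreal (exp (- (Q x / 2))) \<partial>lborel)
    = ennreal \<bar>det A\<bar> * (\<integral>\<^sup>+x. ennreal (exp (- (Q (A *v x) / 2))) \<partial>lborel)"
    using scales_lborel[of A] det(2) unfolding scales_lborel_def by blast
  then show "(\<integral>\<^sup>+x. ennreal (exp (- (Q x / 2))) \<partial>lborel) = ennreal (sqrt ((2 * pi) ^ CARD('k) * det S))"
    by (simp add: QA nn_integral_standard_gaussian det ennreal_mult'[symmetric] real_sqrt_mult mult.commute)
qed

definition normalizer :: real where "normalizer = sqrt ((2 * pi) ^ CARD('k) * det S)"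

lemma normalizer_pos: "normalizer > 0"
  using det_pos by (simp add: normalizer_def)

lemma sets_N [measurable_cong, simp]: "sets (N \<theta>) = sets borel"
  by (simp add: mvnormal_def)

lemma space_N [simp]: "space (N \<theta>) = UNIV"
  by (simp add: mvnormal_def)

lemma nn_integral_N:
  assumes [measurable]: "f \<in> borel_measurable borel"
  shows "(\<integral>\<^sup>+x. f x \<partial>N \<theta>) = (\<integral>\<^sup>+x. ennreal (exp (- (Q x / 2)) / normalizer) * f (x + \<theta>) \<partial>lborel)"
proof -
  have "(\<integral>\<^sup>+x. f x \<partial>N \<theta>) = (\<integral>\<^sup>+x. ennreal (exp (- (Q (x - \<theta>) / 2)) / normalizer) * f x \<partial>lborel)"
    by (simp add: mvnormal_def normalizer_def nn_integral_density)
  also have "\<dots> = (\<integral>\<^sup>+x. ennreal (exp (- (Q (x + \<theta> - \<theta>) / 2)) / normalizer) * f (x + \<theta>) \<partial>lborel)"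
    by (rule nn_integral_lborel_translate[symmetric]) measurable
  finally show ?thesis by simp
qed

lemma nn_integral_N_translate:
  assumes [measurable]: "f \<in> borel_measurable borel"
  shows "(\<integral>\<^sup>+x. f x \<partial>N \<theta>) = (\<integral>\<^sup>+x. f (x + \<theta>) \<partial>N 0)"
  by (simp add: nn_integral_N)

lemma prob_space_N: "prob_space (N \<theta>)"
proof
  have "emeasure (N \<theta>) (space (N \<theta>)) = (\<integral>\<^sup>+x. 1 \<partial>N \<theta>)" by simp
  also have "\<dots> = (\<integral>\<^sup>+x. ennreal (exp (- (Q x / 2))) / ennreal normalizer \<partial>lborel)"
    using normalizer_pos by (subst nn_integral_N) (simp_all add: divide_ennreal)
  also have "\<dots> = 1"
    using normalizer_pos by (subst nn_integral_divide) (simp_all only: nn_integral_exp_Q flip: normalizer_def, auto simp: divide_ennreal)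
  finally show "emeasure (N \<theta>) (space (N \<theta>)) = 1" .
qed

sublocale N: prob_space "N \<theta>" for \<theta> by (rule prob_space_N)

end

section \<open>Upper bound: hard thresholding\<close>

context covariance
begin

lemma nn_integral_sampling_dist_component:
  assumes i: "i \<in> {1..n}" and [measurable]: "f \<in> borel_measurable borel"
  shows "(\<integral>\<^sup>+x. f (x i) \<partial>sampling_dist n S \<theta>) = (\<integral>\<^sup>+y. f y \<partial>N (\<theta> i))"
proof -
  have "(\<integral>\<^sup>+y. f y \<partial>N (\<theta> i)) = (\<integral>\<^sup>+y. f y \<partial>distr (sampling_dist n S \<theta>) (N (\<theta> i)) (\<lambda>x. x i))"
    using distr_PiM_component[of "{1..n}" "\<lambda>i. N (\<theta> i)" i] i
    by (simp add: sampling_dist_def prob_space_N)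
  also have "\<dots> = (\<integral>\<^sup>+x. f (x i) \<partial>sampling_dist n S \<theta>)"
  proof (rule nn_integral_distr)
    show "(\<lambda>x. x i) \<in> sampling_dist n S \<theta> \<rightarrow>\<^sub>M N (\<theta> i)"
      unfolding sampling_dist_def by (rule measurable_component_singleton) (rule i)
  qed simp
  finally show ?thesis by simp
qed

text \<open>
  Multiplying the density by \<open>exp (a Q / 2)\<close> leaves \<open>exp (- (1 - a) Q / 2)\<close>, which is again a
  Gaussian, dilated by \<open>1 / sqrt (1 - a)\<close>.
\<close>
lemma exp_moment_finite:
  assumes "a < 1"
  shows "(\<integral>\<^sup>+z. ennreal (exp (a * Q z / 2)) \<partial>N 0) < \<infinity>"
proof -
  define c where "c = 1 / sqrt (1 - a)"
  have c: "c > 0" "(1 - a) * c\<^sup>2 = 1"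
    using assms by (auto simp: c_def power_divide)
  have "(\<integral>\<^sup>+z. ennreal (exp (a * Q z / 2)) \<partial>N 0)
    = (\<integral>\<^sup>+z. ennreal (1 / normalizer) * ennreal (exp (- ((1 - a) * Q z / 2))) \<partial>lborel)"
    using normalizer_pos
    by (simp add: nn_integral_N ennreal_mult'[symmetric] exp_add[symmetric] algebra_simps diff_divide_distrib)
  also have "\<dots> = ennreal (1 / normalizer) * (\<integral>\<^sup>+z. ennreal (exp (- ((1 - a) * Q z / 2))) \<partial>lborel)"
    by (simp add: nn_integral_cmult)
  also have "(\<integral>\<^sup>+z. ennreal (exp (- ((1 - a) * Q z / 2))) \<partial>lborel)
    = (\<integral>\<^sup>+z. ennreal (exp (- ((1 - a) * Q z / 2))) \<partial>density (distr lborel borel (\<lambda>x. 0 + c *\<^sub>R x)) (\<lambda>_. ennreal (\<bar>c\<bar> ^ DIM(real^'k))))"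
    using c(1) by (subst lborel_affine[of c 0]) (simp_all add: ennreal_power)
  also have "\<dots> = ennreal (\<bar>c\<bar> ^ DIM(real^'k)) * (\<integral>\<^sup>+z. ennreal (exp (- ((1 - a) * Q (c *\<^sub>R z) / 2))) \<partial>lborel)"
    by (simp add: nn_integral_density nn_integral_distr nn_integral_cmult)
  also have "(\<integral>\<^sup>+z. ennreal (exp (- ((1 - a) * Q (c *\<^sub>R z) / 2))) \<partial>lborel) = (\<integral>\<^sup>+z. ennreal (exp (- (Q z / 2))) \<partial>lborel)"
    using c(2) by (simp add: Q_scaleR mult.assoc[symmetric])
  finally show ?thesis
    by (simp only: nn_integral_exp_Q) (simp add: ennreal_mult_less_top)
qed

text \<open>
  The factor \<open>Q z\<close> costs a small multiple \<open>b\<close> of \<open>Q z / 2\<close> in the exponent, and \<open>a + b\<close> is still below 1.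
\<close>
lemma weighted_moment_finite:
  assumes "0 \<le> a" "a < 1"
  obtains C where "C \<ge> 0" "(\<integral>\<^sup>+z. ennreal (Q z * exp (a * Q z / 2)) \<partial>N 0) \<le> ennreal C"
proof -
  define b where "b = (1 - a) / 2"
  have b: "b > 0" "a + b < 1" using assms by (auto simp: b_def field_simps)
  have "Q z * exp (a * Q z / 2) \<le> (2 / b) * exp ((a + b) * Q z / 2)" for z
  proof -
    have "b * Q z / 2 \<le> exp (b * Q z / 2)"
      using exp_ge_add_one_self[of "b * Q z / 2"] by linarith
    then have "Q z \<le> (2 / b) * exp (b * Q z / 2)"
      using b by (simp add: field_simps)
    then have "Q z * exp (a * Q z / 2) \<le> (2 / b) * exp (b * Q z / 2) * exp (a * Q z / 2)"
      by (rule mult_right_mono) simp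
    then show ?thesis
      by (simp add: mult.assoc mult_exp_exp algebra_simps add_divide_distrib)
  qed
  then have "(\<integral>\<^sup>+z. ennreal (Q z * exp (a * Q z / 2)) \<partial>N 0)
    \<le> (\<integral>\<^sup>+z. ennreal (2 / b) * ennreal (exp ((a + b) * Q z / 2)) \<partial>N 0)"
    using b by (intro nn_integral_mono) (simp add: ennreal_mult'[symmetric])
  also have "\<dots> = ennreal (2 / b) * (\<integral>\<^sup>+z. ennreal (exp ((a + b) * Q z / 2)) \<partial>N 0)"
    by (rule nn_integral_cmult) measurable
  also have "\<dots> < \<infinity>"
    using exp_moment_finite[OF b(2)] by (simp add: ennreal_mult_less_top)
  finally show thesis
    by (intro that[of "enn2real (\<integral>\<^sup>+z. ennreal (Q z * exp (a * Q z / 2)) \<partial>N 0)"]) simp_all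
qed

definition hard_threshold :: "real \<Rightarrow> real^'k \<Rightarrow> real^'k" where
  "hard_threshold \<tau> y = (if \<tau> \<le> Q y then y else 0)"

lemma measurable_hard_threshold [measurable]: "hard_threshold \<tau> \<in> borel_measurable borel"
  unfolding hard_threshold_def[abs_def] by measurable

text \<open>
  Where the threshold is passed, \<open>1 \<le> exp (a (Q y - \<tau>) / 2)\<close>; the integral that remains is the
  exponentially weighted second moment \<open>C\<close>.
\<close>
lemma hard_threshold_null_risk:
  assumes "0 \<le> a" and C: "(\<integral>\<^sup>+z. ennreal (Q z * exp (a * Q z / 2)) \<partial>N 0) \<le> ennreal C"
  shows "(\<integral>\<^sup>+y. ennreal (Q (hard_threshold \<tau> y)) \<partial>N 0) \<le> ennreal (exp (- (a * \<tau> / 2)) * C)"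
proof -
  have "Q (hard_threshold \<tau> y) \<le> exp (- (a * \<tau> / 2)) * (Q y * exp (a * Q y / 2))" for y
  proof (cases "\<tau> \<le> Q y")
    case True
    then have "1 \<le> exp (- (a * \<tau> / 2) + a * Q y / 2)"
      using assms(1) by (simp add: mult_left_mono)
    then have "Q y * 1 \<le> Q y * exp (- (a * \<tau> / 2) + a * Q y / 2)"
      by (rule mult_left_mono) simp
    then show ?thesis using True unfolding hard_threshold_def exp_add by (simp add: mult_ac)
  qed (simp add: hard_threshold_def)
  then have "(\<integral>\<^sup>+y. ennreal (Q (hard_threshold \<tau> y)) \<partial>N 0)
    \<le> (\<integral>\<^sup>+y. ennreal (exp (- (a * \<tau> / 2))) * ennreal (Q y * exp (a * Q y / 2)) \<partial>N 0)"
    by (intro nn_integral_mono) (simp add: ennreal_mult'[symmetric])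
  also have "\<dots> = ennreal (exp (- (a * \<tau> / 2))) * (\<integral>\<^sup>+y. ennreal (Q y * exp (a * Q y / 2)) \<partial>N 0)"
    by (rule nn_integral_cmult) measurable
  also have "\<dots> \<le> ennreal (exp (- (a * \<tau> / 2))) * ennreal C"
    using C by (rule mult_left_mono) simp
  finally show ?thesis by (simp add: ennreal_mult')
qed

text \<open>
  Either the observation is kept and the loss is \<open>Q\<close> of the noise, or it is dropped, and then
  \<open>\<theta>\<close> is the sum of a vector with \<open>Q\<close>-value below \<open>\<tau>\<close> and minus the noise.
\<close>
lemma hard_threshold_risk:
  assumes "d > 0" "\<tau> \<ge> 0" "C \<ge> 0" and C: "(\<integral>\<^sup>+z. ennreal (Q z) \<partial>N 0) \<le> ennreal C"
  shows "(\<integral>\<^sup>+y. ennreal (Q (hard_threshold \<tau> y - \<theta>)) \<partial>N \<theta>) \<le> ennreal ((1 + d) * \<tau> + (1 + 1 / d) * C)"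
proof -
  have "Q (hard_threshold \<tau> (z + \<theta>) - \<theta>) \<le> (1 + d) * \<tau> + (1 + 1 / d) * Q z" for z
  proof (cases "\<tau> \<le> Q (z + \<theta>)")
    case True
    have "0 \<le> (1 + d) * \<tau>" "0 \<le> 1 / d * Q z" using assms by auto
    then show ?thesis using True by (simp add: hard_threshold_def algebra_simps)
  next
    case False
    have "Q \<theta> \<le> (1 + d) * Q (z + \<theta>) + (1 + 1 / d) * Q z"
      using Q_add_le[OF assms(1), of "z + \<theta>" "- z"] by simp
    also have "\<dots> \<le> (1 + d) * \<tau> + (1 + 1 / d) * Q z"
      using False assms(1) by (intro add_mono mult_left_mono) auto
    finally show ?thesis using False by (simp add: hard_threshold_def)
  qed
  then have "(\<integral>\<^sup>+y. ennreal (Q (hard_threshold \<tau> y - \<theta>)) \<partial>N \<theta>)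
    \<le> (\<integral>\<^sup>+z. ennreal ((1 + d) * \<tau>) + ennreal (1 + 1 / d) * ennreal (Q z) \<partial>N 0)"
    using assms
    by (subst nn_integral_N_translate) (auto intro!: nn_integral_mono simp: ennreal_mult'[symmetric] simp flip: ennreal_plus)
  also have "\<dots> = ennreal ((1 + d) * \<tau>) + ennreal (1 + 1 / d) * (\<integral>\<^sup>+z. ennreal (Q z) \<partial>N 0)"
    by (subst nn_integral_add) (auto simp: nn_integral_cmult N.emeasure_space_1[simplified])
  also have "\<dots> \<le> ennreal ((1 + d) * \<tau>) + ennreal (1 + 1 / d) * ennreal C"
    by (intro add_left_mono mult_left_mono C) simp
  also have "\<dots> = ennreal ((1 + d) * \<tau> + (1 + 1 / d) * C)"
    using assms(1-3) by (simp add: ennreal_mult'[symmetric] flip: ennreal_plus)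
  finally show ?thesis .
qed

text \<open>
  The exponent \<open>a = 1 / (1 + d)\<close> and the threshold \<open>\<tau> = 2 (1 + d) L\<close> are matched so that
  \<open>exp (- a \<tau> / 2)\<close> is exactly \<open>q / n\<close>; the \<open>n\<close> null coordinates then contribute no more than \<open>C q\<close>.
\<close>
proposition minimax_risk_upper:
  assumes d: "d > 0"
  obtains C where "\<And>n q. \<lbrakk>0 < q; q < n\<rbrakk> \<Longrightarrow>
    minimax_risk n q S \<le> ennreal (2 * real q * ln (real n / real q) * (1 + d)\<^sup>2 + C * real q)"
proof -
  define a where "a = 1 / (1 + d)"
  have a: "0 \<le> a" "a < 1" using d by (auto simp: a_def)
  obtain Ca where Ca: "Ca \<ge> 0" "(\<integral>\<^sup>+z. ennreal (Q z * exp (a * Q z / 2)) \<partial>N 0) \<le> ennreal Ca"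
    using weighted_moment_finite[OF a] by blast
  obtain C0 where C0: "C0 \<ge> 0" "(\<integral>\<^sup>+z. ennreal (Q z) \<partial>N 0) \<le> ennreal C0"
    using weighted_moment_finite[of 0] by auto
  show thesis
  proof (rule that[of "(1 + 1 / d) * C0 + Ca"])
    fix n q :: nat assume q: "0 < q" "q < n"
    define L where "L = ln (real n / real q)"
    have L: "L > 0" using q by (auto simp: L_def)
    define \<tau> where "\<tau> = 2 * (1 + d) * L"
    have \<tau>: "\<tau> \<ge> 0" using L d by (simp add: \<tau>_def)
    have e\<tau>: "exp (- (a * \<tau> / 2)) = real q / real n"
    proof -
      have "a * \<tau> / 2 = (a * (1 + d)) * L" by (simp add: \<tau>_def)
      also have "a * (1 + d) = 1" using d by (simp add: a_def)
      finally have "a * \<tau> / 2 = L" by simp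
      then show ?thesis using q by (simp add: L_def exp_minus)
    qed
    define T where "T = (\<lambda>x. \<lambda>i\<in>{1..n}. hard_threshold \<tau> (x i))"
    have T: "T \<in> estimators n"
      unfolding T_def estimators_def by measurable
    define b0 where "b0 = real q / real n * Ca"
    define b1 where "b1 = (1 + d) * \<tau> + (1 + 1 / d) * C0"
    have b: "b0 \<ge> 0" "b1 \<ge> 0" using Ca C0 d \<tau> by (auto simp: b0_def b1_def)
    have "risk n S T \<theta> \<le> ennreal (real n * b0 + real q * b1)" if "\<theta> \<in> nearly_black n q" for \<theta> :: "nat \<Rightarrow> real^'k"
    proof -
      have "risk n S T \<theta> \<le> (\<Sum>i = 1..n. ennreal (b0 + of_bool (\<theta> i \<noteq> 0) * b1))"
        unfolding risk_def
      proof (rule sum_mono)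
        fix i assume i: "i \<in> {1..n}"
        have "(\<integral>\<^sup>+x. ennreal (Q (T x i - \<theta> i)) \<partial>sampling_dist n S \<theta>)
          = (\<integral>\<^sup>+x. ennreal (Q (hard_threshold \<tau> (x i) - \<theta> i)) \<partial>sampling_dist n S \<theta>)"
          using i by (simp add: T_def)
        also have "\<dots> = (\<integral>\<^sup>+y. ennreal (Q (hard_threshold \<tau> y - \<theta> i)) \<partial>N (\<theta> i))"
          using i by (rule nn_integral_sampling_dist_component) measurable
        also have "\<dots> \<le> ennreal (b0 + of_bool (\<theta> i \<noteq> 0) * b1)"
        proof (cases "\<theta> i = 0")
          case True
          then show ?thesis
            using hard_threshold_null_risk[OF a(1) Ca(2), of \<tau>] by (simp add: e\<tau> b0_def)
        next
          case False
          have "(\<integral>\<^sup>+y. ennreal (Q (hard_threshold \<tau> y - \<theta> i)) \<partial>N (\<theta> i)) \<le> ennreal b1"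
            unfolding b1_def by (rule hard_threshold_risk[OF d \<tau> C0])
          also have "\<dots> \<le> ennreal (b0 + of_bool (\<theta> i \<noteq> 0) * b1)"
            using False b by (intro ennreal_leI) simp
          finally show ?thesis .
        qed
        finally show "(\<integral>\<^sup>+x. ennreal (Q (T x i - \<theta> i)) \<partial>sampling_dist n S \<theta>) \<le> ennreal (b0 + of_bool (\<theta> i \<noteq> 0) * b1)" .
      qed
      also have "\<dots> = ennreal (\<Sum>i = 1..n. b0 + of_bool (\<theta> i \<noteq> 0) * b1)"
        using b by (intro sum_ennreal) auto
      also have "(\<Sum>i = 1..n. b0 + of_bool (\<theta> i \<noteq> 0) * b1) = real n * b0 + real (\<Sum>i = 1..n. of_bool (\<theta> i \<noteq> 0)) * b1"
        by (simp only: sum.distrib sum_distrib_right[symmetric] of_nat_sum of_nat_of_bool) simp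
      also have "ennreal \<dots> \<le> ennreal (real n * b0 + real q * b1)"
        using that b unfolding nearly_black_def
        by (intro ennreal_leI add_left_mono mult_right_mono) (auto simp del: of_nat_sum sum_of_bool_eq)
      finally show ?thesis .
    qed
    then have "(SUP \<theta>\<in>nearly_black n q. risk n S T \<theta>) \<le> ennreal (real n * b0 + real q * b1)"
      by (rule SUP_least)
    then have "minimax_risk n q S \<le> ennreal (real n * b0 + real q * b1)"
      unfolding minimax_risk_def by (rule INF_lower2[OF T])
    also have "real n * b0 + real q * b1 = 2 * real q * ln (real n / real q) * (1 + d)\<^sup>2 + ((1 + 1 / d) * C0 + Ca) * real q"
      using q by (simp add: b0_def b1_def \<tau>_def L_def power2_eq_square algebra_simps)
    finally show "minimax_risk n q S \<le> ennreal (2 * real q * ln (real n / real q) * (1 + d)\<^sup>2 + ((1 + 1 / d) * C0 + Ca) * real q)" .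
  qed
qed

end

section \<open>Products of densities\<close>

text \<open>
  Both measures agree on boxes, where the integral of the product factorises.
\<close>
lemma density_PiM:
  fixes I :: "'i set" and M :: "'i \<Rightarrow> 'a measure" and f :: "'i \<Rightarrow> 'a \<Rightarrow> ennreal"
  assumes I: "finite I" and M: "\<And>i. prob_space (M i)"
    and D: "\<And>i. prob_space (density (M i) (f i))"
    and f[measurable]: "\<And>i. f i \<in> borel_measurable (M i)"
  shows "density (PiM I M) (\<lambda>x. \<Prod>i\<in>I. f i (x i)) = PiM I (\<lambda>i. density (M i) (f i))"
proof -
  interpret M: product_sigma_finite M
    by (simp add: product_sigma_finite_def prob_space_imp_sigma_finite M)
  interpret D: product_sigma_finite "\<lambda>i. density (M i) (f i)"
    by (simp add: product_sigma_finite_def prob_space_imp_sigma_finite D)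
  have fI[measurable]: "(\<lambda>x. \<Prod>i\<in>I. f i (x i)) \<in> borel_measurable (PiM I M)"
    by measurable
  show ?thesis
  proof (rule D.PiM_eqI[OF I])
    show "sets (density (PiM I M) (\<lambda>x. \<Prod>i\<in>I. f i (x i))) = sets (PiM I (\<lambda>i. density (M i) (f i)))"
      by (simp cong: sets_PiM_cong)
    fix A assume "\<And>i. i \<in> I \<Longrightarrow> A i \<in> sets (density (M i) (f i))"
    then have A[measurable]: "\<And>i. i \<in> I \<Longrightarrow> A i \<in> sets (M i)" by simp
    then have "emeasure (density (PiM I M) (\<lambda>x. \<Prod>i\<in>I. f i (x i))) (Pi\<^sub>E I A)
      = (\<integral>\<^sup>+x. (\<Prod>i\<in>I. f i (x i)) * indicator (Pi\<^sub>E I A) x \<partial>PiM I M)"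
      using I by (intro emeasure_density) (auto intro!: sets_PiM_I_finite)
    also have "\<dots> = (\<integral>\<^sup>+x. (\<Prod>i\<in>I. f i (x i) * indicator (A i) (x i)) \<partial>PiM I M)"
    proof (rule nn_integral_cong)
      fix x assume "x \<in> space (PiM I M)"
      then have "indicator (Pi\<^sub>E I A) x = (\<Prod>i\<in>I. indicator (A i) (x i) :: ennreal)"
        using I by (auto simp: indicator_def PiE_iff space_PiM prod_zero_iff)
      then show "(\<Prod>i\<in>I. f i (x i)) * indicator (Pi\<^sub>E I A) x = (\<Prod>i\<in>I. f i (x i) * indicator (A i) (x i))"
        by (simp add: prod.distrib)
    qed
    also have "\<dots> = (\<Prod>i\<in>I. \<integral>\<^sup>+y. f i y * indicator (A i) y \<partial>M i)"
      using I by (intro M.product_nn_integral_prod) auto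
    also have "\<dots> = (\<Prod>i\<in>I. emeasure (density (M i) (f i)) (A i))"
      using A by (intro prod.cong) (auto simp: emeasure_density)
    finally show "emeasure (density (PiM I M) (\<lambda>x. \<Prod>i\<in>I. f i (x i))) (Pi\<^sub>E I A)
      = (\<Prod>i\<in>I. emeasure (density (M i) (f i)) (A i))" .
  qed
qed

section \<open>Lower bound: the Bayes risk of one block\<close>

context covariance
begin

text \<open>The likelihood ratio of mean \<open>\<mu>\<close> against mean zero.\<close>
definition lratio :: "real^'k \<Rightarrow> real^'k \<Rightarrow> real" where
  "lratio \<mu> y = exp (ip \<mu> y - Q \<mu> / 2)"

lemma lratio_pos: "lratio \<mu> y > 0" by (simp add: lratio_def)

lemma measurable_lratio [measurable]: "lratio \<mu> \<in> borel_measurable borel"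
  unfolding lratio_def[abs_def] by measurable

lemma N_eq_density: "N \<mu> = density (N 0) (\<lambda>y. ennreal (lratio \<mu> y))"
proof -
  have "exp (- (Q (y - \<mu>) / 2)) = exp (- (Q y / 2)) * lratio \<mu> y" for y
  proof -
    have "- (Q (y - \<mu>) / 2) = - (Q y / 2) + (ip \<mu> y - Q \<mu> / 2)"
      by (simp add: Q_ip ip_linear ip_commute[of y \<mu>] field_simps)
    then show ?thesis by (simp only: lratio_def exp_add)
  qed
  then show ?thesis
    unfolding mvnormal_def by (subst density_density_eq) (auto simp: ennreal_mult'[symmetric] lratio_pos less_imp_le det_pos)
qed

lemma prob_space_sampling_dist: "prob_space (sampling_dist n S \<theta>)"
  unfolding sampling_dist_def by (rule prob_space_PiM) (rule prob_space_N)

lemma sets_sampling_dist [measurable_cong, simp]: "sets (sampling_dist n S \<theta>) = sets (PiM {1..n} (\<lambda>_. borel))"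
  unfolding sampling_dist_def by (simp cong: sets_PiM_cong)

text \<open>
  All laws with a single spike in a given block are compared with the law without a spike there: the
  density depends on the spiked coordinate only.
\<close>
lemma sampling_dist_spike:
  assumes j: "j \<in> {1..n}" and \<theta>: "\<theta> j = 0"
  shows "sampling_dist n S (\<theta>(j := \<mu>)) = density (sampling_dist n S \<theta>) (\<lambda>x. ennreal (lratio \<mu> (x j)))"
proof -
  define f where "f i = (if i = j then (\<lambda>y. ennreal (lratio \<mu> y)) else (\<lambda>_. 1))" for i
  have D: "density (N (\<theta> i)) (f i) = N ((\<theta>(j := \<mu>)) i)" for i
    using \<theta> by (auto simp: f_def density_1 N_eq_density[symmetric])
  have "density (sampling_dist n S \<theta>) (\<lambda>x. \<Prod>i\<in>{1..n}. f i (x i)) = sampling_dist n S (\<theta>(j := \<mu>))"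
    unfolding sampling_dist_def D[symmetric]
    by (rule density_PiM) (simp_all add: prob_space_N D, simp add: f_def)
  moreover have "(\<Prod>i\<in>{1..n}. f i (x i)) = ennreal (lratio \<mu> (x j))" for x
  proof -
    have "(\<Prod>i\<in>{1..n}. f i (x i)) = (\<Prod>i\<in>{1..n}. if i = j then ennreal (lratio \<mu> (x j)) else 1)"
      by (rule prod.cong) (auto simp: f_def)
    also have "\<dots> = ennreal (lratio \<mu> (x j))" using j by (subst prod.delta) auto
    finally show ?thesis .
  qed
  ultimately show ?thesis by simp
qed

text \<open>
  Estimating a coordinate that is \<open>\<mu>\<close> with weight \<open>\<alpha>\<close> and zero with weight \<open>s - \<alpha>\<close>: the weighted
  loss is minimal at \<open>t = (\<alpha> / s) \<mu>\<close>, and the left-hand side is its value there.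
\<close>
lemma two_point_loss:
  assumes "\<alpha> > 0" "\<alpha> \<le> s"
  shows "Q \<mu> * (\<alpha> * (1 - \<alpha> / s)) \<le> \<alpha> * Q (t - \<mu>) + (s - \<alpha>) * Q t"
proof -
  have "0 \<le> s * Q (t - (\<alpha> / s) *\<^sub>R \<mu>)" using assms by simp
  also have "\<dots> = \<alpha> * Q (t - \<mu>) + (s - \<alpha>) * Q t - Q \<mu> * (\<alpha> * (1 - \<alpha> / s))"
    using assms by (simp add: Q_ip ip_linear ip_commute[of \<mu> t] field_simps power2_eq_square)
  finally show ?thesis by simp
qed

text \<open>
  The posterior weights of the spike positions are \<open>L j / sum L J\<close>; adding \<open>two_point_loss\<close> over the
  coordinates of the block bounds the loss of any estimate \<open>t\<close> from below.
\<close>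
lemma block_loss:
  fixes t :: "'i \<Rightarrow> real^'k"
  assumes J: "finite J" and L: "\<And>j. j \<in> J \<Longrightarrow> L j > 0"
  shows "(\<Sum>j\<in>J. L j * (Q \<mu> * (1 - L j / sum L J)))
    \<le> (\<Sum>j'\<in>J. L j' * (\<Sum>j\<in>J. Q (t j - (if j = j' then \<mu> else 0))))"
proof -
  have "(\<Sum>j'\<in>J. L j' * (\<Sum>j\<in>J. Q (t j - (if j = j' then \<mu> else 0))))
    = (\<Sum>j\<in>J. \<Sum>j'\<in>J. L j' * Q (t j - (if j = j' then \<mu> else 0)))"
    unfolding sum_distrib_left by (rule sum.swap)
  also have "\<dots> = (\<Sum>j\<in>J. L j * Q (t j - \<mu>) + (sum L J - L j) * Q (t j))"
  proof (rule sum.cong)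
    fix j assume j: "j \<in> J"
    have "(\<Sum>j'\<in>J. L j' * Q (t j - (if j = j' then \<mu> else 0)))
      = L j * Q (t j - \<mu>) + (\<Sum>j'\<in>J - {j}. L j' * Q (t j - (if j = j' then \<mu> else 0)))"
      by (subst sum.remove[OF J j]) simp
    also have "(\<Sum>j'\<in>J - {j}. L j' * Q (t j - (if j = j' then \<mu> else 0))) = sum L (J - {j}) * Q (t j)"
      unfolding sum_distrib_right by (rule sum.cong) auto
    also have "sum L (J - {j}) = sum L J - L j" by (simp add: sum.remove[OF J j])
    finally show "(\<Sum>j'\<in>J. L j' * Q (t j - (if j = j' then \<mu> else 0))) = L j * Q (t j - \<mu>) + (sum L J - L j) * Q (t j)" .
  qed simp
  also have "\<dots> \<ge> (\<Sum>j\<in>J. L j * (Q \<mu> * (1 - L j / sum L J)))"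
  proof (rule sum_mono)
    fix j assume j: "j \<in> J"
    have "L j \<le> sum L J" using j J L by (intro member_le_sum) (auto intro: less_imp_le)
    then show "L j * (Q \<mu> * (1 - L j / sum L J)) \<le> L j * Q (t j - \<mu>) + (sum L J - L j) * Q (t j)"
      using two_point_loss[OF L[OF j], of "sum L J" \<mu> "t j"] by (simp add: mult_ac)
  qed
  finally show ?thesis .
qed

text \<open>
  Written as integrals against the law \<open>sampling_dist n S \<theta>\<close>, where \<open>\<theta>\<close> has no spike in \<open>J\<close>, both
  sides are compared pointwise by \<open>block_loss\<close>.  The left-hand side involves the data alone and no
  longer the estimator.
\<close>
lemma block_risk_ge_posterior:
  fixes T :: "(nat \<Rightarrow> real^'k) \<Rightarrow> nat \<Rightarrow> real^'k"
  assumes J: "J \<subseteq> {1..n}" and \<theta>: "\<And>j. j \<in> J \<Longrightarrow> \<theta> j = 0" and T: "T \<in> estimators n"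
  shows "(\<Sum>j\<in>J. \<integral>\<^sup>+x. ennreal (Q \<mu> * (1 - lratio \<mu> (x j) / (\<Sum>i\<in>J. lratio \<mu> (x i)))) \<partial>sampling_dist n S (\<theta>(j := \<mu>)))
    \<le> (\<Sum>j'\<in>J. \<Sum>j\<in>J. \<integral>\<^sup>+x. ennreal (Q (T x j - (if j = j' then \<mu> else 0))) \<partial>sampling_dist n S (\<theta>(j' := \<mu>)))"
proof -
  let ?P = "sampling_dist n S \<theta>"
  let ?L = "\<lambda>x j. lratio \<mu> (x j)"
  have fin: "finite J" using J finite_subset by blast
  have comp[measurable]: "(\<lambda>x. x j) \<in> PiM {1..n} (\<lambda>_. borel) \<rightarrow>\<^sub>M (borel :: (real^'k) measure)" if "j \<in> J" for j
    using that J by (intro measurable_component_singleton) auto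
  have T': "T \<in> PiM {1..n} (\<lambda>_. borel) \<rightarrow>\<^sub>M PiM {1..n} (\<lambda>_. borel)" using T by (simp add: estimators_def)
  have Tj[measurable]: "(\<lambda>x. T x j) \<in> borel_measurable (PiM {1..n} (\<lambda>_. borel))" if "j \<in> J" for j
    using measurable_compose[OF T' comp[OF that]] .
  have P: "(\<integral>\<^sup>+x. f x \<partial>sampling_dist n S (\<theta>(j := \<mu>))) = (\<integral>\<^sup>+x. ennreal (?L x j) * f x \<partial>?P)"
    if "j \<in> J" and [measurable]: "f \<in> borel_measurable (PiM {1..n} (\<lambda>_. borel))" for j f
  proof -
    have [measurable]: "(\<lambda>x. x j) \<in> PiM {1..n} (\<lambda>_. borel) \<rightarrow>\<^sub>M (borel :: (real^'k) measure)"
      by (rule comp) (rule that)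
    show ?thesis
      using that J \<theta> by (subst sampling_dist_spike) (auto simp: nn_integral_density)
  qed
  have mL: "(\<lambda>x. ennreal (Q \<mu> * (1 - ?L x j / (\<Sum>i\<in>J. ?L x i)))) \<in> borel_measurable (PiM {1..n} (\<lambda>_. borel))"
    if "j \<in> J" for j using that by measurable
  have mT: "(\<lambda>x. ennreal (Q (T x j - (if j = j' then \<mu> else 0)))) \<in> borel_measurable (PiM {1..n} (\<lambda>_. borel))"
    if "j \<in> J" for j j' using that by measurable
  have mLT: "(\<lambda>x. ennreal (?L x j') * ennreal (Q (T x j - (if j = j' then \<mu> else 0)))) \<in> borel_measurable ?P"
    if "j \<in> J" "j' \<in> J" for j j' using that by measurable
  have "(\<Sum>j\<in>J. \<integral>\<^sup>+x. ennreal (Q \<mu> * (1 - ?L x j / (\<Sum>i\<in>J. ?L x i))) \<partial>sampling_dist n S (\<theta>(j := \<mu>)))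
    = (\<Sum>j\<in>J. \<integral>\<^sup>+x. ennreal (?L x j) * ennreal (Q \<mu> * (1 - ?L x j / (\<Sum>i\<in>J. ?L x i))) \<partial>?P)"
    by (intro sum.cong refl P mL)
  also have "\<dots> = (\<integral>\<^sup>+x. (\<Sum>j\<in>J. ennreal (?L x j) * ennreal (Q \<mu> * (1 - ?L x j / (\<Sum>i\<in>J. ?L x i)))) \<partial>?P)"
    by (rule nn_integral_sum[symmetric]) measurable
  also have "\<dots> \<le> (\<integral>\<^sup>+x. (\<Sum>j'\<in>J. \<Sum>j\<in>J. ennreal (?L x j') * ennreal (Q (T x j - (if j = j' then \<mu> else 0)))) \<partial>?P)"
  proof (rule nn_integral_mono)
    fix x
    have le: "?L x j / (\<Sum>i\<in>J. ?L x i) \<le> 1" if "j \<in> J" for j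
    proof -
      have "?L x j \<le> (\<Sum>i\<in>J. ?L x i)" using that fin lratio_pos by (intro member_le_sum) (auto intro: less_imp_le)
      then show ?thesis using lratio_pos[of \<mu> "x j"] by (simp add: divide_le_eq)
    qed
    have "(\<Sum>j\<in>J. ennreal (?L x j) * ennreal (Q \<mu> * (1 - ?L x j / (\<Sum>i\<in>J. ?L x i))))
      = ennreal (\<Sum>j\<in>J. ?L x j * (Q \<mu> * (1 - ?L x j / (\<Sum>i\<in>J. ?L x i))))"
      using le lratio_pos by (simp add: ennreal_mult'[symmetric] less_imp_le)
    also have "\<dots> \<le> ennreal (\<Sum>j'\<in>J. ?L x j' * (\<Sum>j\<in>J. Q (T x j - (if j = j' then \<mu> else 0))))"
      by (intro ennreal_leI block_loss fin lratio_pos)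
    also have "\<dots> = (\<Sum>j'\<in>J. \<Sum>j\<in>J. ennreal (?L x j') * ennreal (Q (T x j - (if j = j' then \<mu> else 0))))"
      unfolding sum_distrib_left using lratio_pos
      by (simp add: sum_nonneg ennreal_mult'[symmetric] less_imp_le)
    finally show "(\<Sum>j\<in>J. ennreal (?L x j) * ennreal (Q \<mu> * (1 - ?L x j / (\<Sum>i\<in>J. ?L x i))))
      \<le> (\<Sum>j'\<in>J. \<Sum>j\<in>J. ennreal (?L x j') * ennreal (Q (T x j - (if j = j' then \<mu> else 0))))" .
  qed
  also have "\<dots> = (\<Sum>j'\<in>J. \<Sum>j\<in>J. \<integral>\<^sup>+x. ennreal (?L x j') * ennreal (Q (T x j - (if j = j' then \<mu> else 0))) \<partial>?P)"
  proof -
    have "(\<integral>\<^sup>+x. (\<Sum>j'\<in>J. \<Sum>j\<in>J. ennreal (?L x j') * ennreal (Q (T x j - (if j = j' then \<mu> else 0)))) \<partial>?P)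
      = (\<Sum>j'\<in>J. \<integral>\<^sup>+x. (\<Sum>j\<in>J. ennreal (?L x j') * ennreal (Q (T x j - (if j = j' then \<mu> else 0)))) \<partial>?P)"
      by (intro nn_integral_sum borel_measurable_sum mLT)
    also have "\<dots> = (\<Sum>j'\<in>J. \<Sum>j\<in>J. \<integral>\<^sup>+x. ennreal (?L x j') * ennreal (Q (T x j - (if j = j' then \<mu> else 0))) \<partial>?P)"
      by (intro sum.cong refl nn_integral_sum mLT)
    finally show ?thesis .
  qed
  also have "\<dots> = (\<Sum>j'\<in>J. \<Sum>j\<in>J. \<integral>\<^sup>+x. ennreal (Q (T x j - (if j = j' then \<mu> else 0))) \<partial>sampling_dist n S (\<theta>(j' := \<mu>)))"
    by (intro sum.cong refl P[symmetric] mT)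
  finally show ?thesis .
qed

end

section \<open>A spike below its noise level is hidden\<close>

context covariance
begin

lemma measure_N_translate:
  assumes "A \<in> sets borel"
  shows "measure (N \<theta>) A = measure (N 0) {z. z + \<theta> \<in> A}"
proof -
  have [measurable]: "A \<in> sets borel" by (rule assms)
  have "emeasure (N \<theta>) A = emeasure (N 0) {z. z + \<theta> \<in> A}"
  proof -
    have "emeasure (N \<theta>) A = (\<integral>\<^sup>+y. indicator A y \<partial>N \<theta>)" by simp
    also have "\<dots> = (\<integral>\<^sup>+z. indicator A (z + \<theta>) \<partial>N 0)"
      by (rule nn_integral_N_translate) measurable
    also have "\<dots> = (\<integral>\<^sup>+z. indicator {z. z + \<theta> \<in> A} z \<partial>N 0)"
      by (rule nn_integral_cong) (simp add: indicator_def)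
    also have "\<dots> = emeasure (N 0) {z. z + \<theta> \<in> A}"
      by (rule nn_integral_indicator) measurable
    finally show ?thesis .
  qed
  then show ?thesis by (simp add: measure_def)
qed

lemma gaussian_tight:
  assumes "\<eta> > 0"
  obtains K where "K \<ge> 0" "measure (N 0) {z. \<bar>ip e z\<bar> \<le> K} \<ge> 1 - \<eta>"
proof -
  let ?A = "\<lambda>n::nat. {z. \<bar>ip e z\<bar> \<le> real n}"
  have "(\<lambda>n. measure (N 0) (?A n)) \<longlonglongrightarrow> measure (N 0) (\<Union>n. ?A n)"
    by (rule N.finite_Lim_measure_incseq) (auto simp: incseq_def)
  also have "(\<Union>n. ?A n) = UNIV" using real_arch_simple by auto
  also have "measure (N 0) UNIV = 1" using N.prob_space by simp
  finally have "\<forall>\<^sub>F n in sequentially. measure (N 0) (?A n) > 1 - \<eta>"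
    using assms by (intro order_tendstoD) auto
  then obtain n where "measure (N 0) (?A n) > 1 - \<eta>"
    by (auto simp: eventually_sequentially)
  then show thesis by (intro that[of "real n"]) auto
qed

text \<open>
  Tilting.  Under mean \<open>s e\<close> the component \<open>ip e y\<close> lies within \<open>K\<close> of \<open>s\<close> as often as pure noise
  lies within \<open>K\<close> of zero, and on that event the likelihood ratio against mean zero is at most
  \<open>exp (s\<^sup>2 / 2 + s K)\<close>.
\<close>
lemma gaussian_tail_lower:
  assumes e: "Q e = 1" and "s \<ge> 0"
  shows "exp (- (s\<^sup>2 / 2 + s * K)) * measure (N 0) {z. \<bar>ip e z\<bar> \<le> K} \<le> measure (N 0) {z. s - K \<le> ip e z}"
proof -
  let ?C = "{y. \<bar>ip e y - s\<bar> \<le> K}"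
  have ee: "ip e e = 1" using e by (simp add: Q_ip)
  have "measure (N 0) {z. \<bar>ip e z\<bar> \<le> K} = measure (N (s *\<^sub>R e)) ?C"
    by (subst measure_N_translate) (auto simp: ip_linear ee)
  also have "\<dots> \<le> exp (s\<^sup>2 / 2 + s * K) * measure (N 0) ?C"
  proof -
    have "emeasure (N (s *\<^sub>R e)) ?C = (\<integral>\<^sup>+y. ennreal (lratio (s *\<^sub>R e) y) * indicator ?C y \<partial>N 0)"
      by (subst N_eq_density) (simp add: emeasure_density)
    also have "\<dots> \<le> (\<integral>\<^sup>+y. ennreal (exp (s\<^sup>2 / 2 + s * K)) * indicator ?C y \<partial>N 0)"
    proof (intro nn_integral_mono)
      fix y
      have "lratio (s *\<^sub>R e) y \<le> exp (s\<^sup>2 / 2 + s * K)" if "y \<in> ?C"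
      proof -
        have "s * ip e y \<le> s * (s + K)" using that assms by (intro mult_left_mono) auto
        then show ?thesis by (simp add: lratio_def ip_linear Q_scaleR e power2_eq_square algebra_simps)
      qed
      then show "ennreal (lratio (s *\<^sub>R e) y) * indicator ?C y \<le> ennreal (exp (s\<^sup>2 / 2 + s * K)) * indicator ?C y"
        by (auto simp: indicator_def intro!: ennreal_leI)
    qed
    also have "\<dots> = ennreal (exp (s\<^sup>2 / 2 + s * K)) * emeasure (N 0) ?C"
      by (rule nn_integral_cmult_indicator) measurable
    finally show ?thesis
      by (simp add: N.emeasure_eq_measure ennreal_mult'[symmetric])
  qed
  also have "\<dots> \<le> exp (s\<^sup>2 / 2 + s * K) * measure (N 0) {z. s - K \<le> ip e z}"
    by (intro mult_left_mono N.finite_measure_mono) auto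
  finally show ?thesis
    by (simp add: exp_minus field_simps)
qed

text \<open>
  The event fails only if \<open>x j\<close> avoids \<open>A\<close> or if all other coordinates of the block avoid \<open>B\<close>; both
  failure events are boxes, whose probabilities factorise.
\<close>
lemma spike_hidden_probability:
  assumes J: "J \<subseteq> {1..n}" "j \<in> J" and \<theta>: "\<And>i. i \<in> J \<Longrightarrow> \<theta> i = 0"
    and [measurable]: "A \<in> sets borel" "B \<in> sets borel"
  shows "1 - measure (N \<mu>) (- A) - measure (N 0) (- B) ^ (card J - 1)
    \<le> measure (sampling_dist n S (\<theta>(j := \<mu>)))
        {x \<in> space (sampling_dist n S (\<theta>(j := \<mu>))). x j \<in> A \<and> (\<exists>i\<in>J - {j}. x i \<in> B)}"
proof -
  let ?\<theta> = "\<theta>(j := \<mu>)"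
  let ?P = "sampling_dist n S ?\<theta>"
  interpret P: prob_space ?P by (rule prob_space_sampling_dist)
  have fin: "finite J" using J finite_subset by blast
  have box: "measure ?P (prod_emb {1..n} (\<lambda>i. N (?\<theta> i)) I (Pi\<^sub>E I D)) = (\<Prod>i\<in>I. measure (N (?\<theta> i)) (D i))"
    if "I \<subseteq> J" and D: "\<And>i. i \<in> I \<Longrightarrow> D i \<in> sets borel" for I D
  proof -
    have "emeasure ?P (prod_emb {1..n} (\<lambda>i. N (?\<theta> i)) I (Pi\<^sub>E I D)) = (\<Prod>i\<in>I. emeasure (N (?\<theta> i)) (D i))"
      unfolding sampling_dist_def
      using that J fin by (intro emeasure_PiM_emb) (auto simp: prob_space_N intro: finite_subset)
    then show ?thesis
      unfolding P.emeasure_eq_measure N.emeasure_eq_measure by (simp add: prod_ennreal prod_nonneg)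
  qed
  let ?E = "{x \<in> space ?P. x j \<in> A \<and> (\<exists>i\<in>J - {j}. x i \<in> B)}"
  let ?X = "prod_emb {1..n} (\<lambda>i. N (?\<theta> i)) {j} (Pi\<^sub>E {j} (\<lambda>_. - A))"
  let ?Y = "prod_emb {1..n} (\<lambda>i. N (?\<theta> i)) (J - {j}) (Pi\<^sub>E (J - {j}) (\<lambda>_. - B))"
  have X: "measure ?P ?X = measure (N \<mu>) (- A)"
    using J by (subst box) auto
  have "measure ?P ?Y = (\<Prod>i\<in>J - {j}. measure (N (?\<theta> i)) (- B))"
    by (subst box) auto
  also have "\<dots> = (\<Prod>i\<in>J - {j}. measure (N 0) (- B))"
    by (rule prod.cong) (auto simp: \<theta>)
  finally have Y: "measure ?P ?Y = measure (N 0) (- B) ^ (card J - 1)"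
    using J by simp
  have sets: "?X \<in> sets ?P" "?Y \<in> sets ?P"
    unfolding sampling_dist_def using J fin by (auto intro!: sets_PiM_I simp del: sets_sampling_dist)
  have comp: "(\<lambda>x. x i) \<in> PiM {1..n} (\<lambda>_. borel) \<rightarrow>\<^sub>M (borel :: (real^'k) measure)" if "i \<in> J" for i
    using that J by (intro measurable_component_singleton) auto
  note [measurable] = comp comp[OF J(2)]
  have E: "?E \<in> sets ?P"
    using fin by measurable
  have "space ?P \<subseteq> ?E \<union> (?X \<union> ?Y)"
    using J by (auto simp: sampling_dist_def space_PiM prod_emb_def PiE_iff)
  then have "measure ?P (space ?P) \<le> measure ?P (?E \<union> (?X \<union> ?Y))"
    using E sets by (intro P.finite_measure_mono) auto
  also have "\<dots> \<le> measure ?P ?E + measure ?P (?X \<union> ?Y)"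
    using E sets by (intro measure_Un_le) auto
  also have "measure ?P (?X \<union> ?Y) \<le> measure ?P ?X + measure ?P ?Y"
    using sets by (intro measure_Un_le) auto
  finally show ?thesis
    unfolding X Y P.prob_space by linarith
qed

text \<open>
  Take the event that the spiked component is at most \<open>a + K\<close> while some noise component of the block is at
  least \<open>a + K + 1\<close>.  There the likelihood ratio of the true position is at most \<open>exp (- a)\<close> times that of the noise
  coordinate, so the posterior mass of the true position is at most \<open>exp (- a)\<close>.  The level \<open>a + K + 1\<close> is \<open>s - K\<close>, the form in which
  \<open>gaussian_tail_lower\<close> bounds the tail.
\<close>
lemma posterior_spread:
  assumes J: "J \<subseteq> {1..n}" "j \<in> J" and \<theta>: "\<And>i. i \<in> J \<Longrightarrow> \<theta> i = 0"
    and e: "Q e = 1" and a: "a > 0" and K: "K \<ge> 0" and \<eta>: "measure (N 0) {z. \<bar>ip e z\<bar> \<le> K} \<ge> 1 - \<eta>"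
    and "\<eta> < 1"
  defines "s \<equiv> a + 2 * K + 1"
  shows "ennreal (a\<^sup>2 * ((1 - exp (- a)) * (1 - \<eta> - exp (- ((1 - \<eta>) * exp (- (s\<^sup>2 / 2 + s * K)) * real (card J - 1))))))
    \<le> (\<integral>\<^sup>+x. ennreal (Q (a *\<^sub>R e) * (1 - lratio (a *\<^sub>R e) (x j) / (\<Sum>i\<in>J. lratio (a *\<^sub>R e) (x i)))) \<partial>sampling_dist n S (\<theta>(j := a *\<^sub>R e)))"
proof -
  let ?\<mu> = "a *\<^sub>R e"
  let ?P = "sampling_dist n S (\<theta>(j := ?\<mu>))"
  let ?A = "{y. ip e y \<le> a + K}" and ?B = "{y. a + K + 1 \<le> ip e y}"
  let ?E = "{x \<in> space ?P. x j \<in> ?A \<and> (\<exists>i\<in>J - {j}. x i \<in> ?B)}"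
  interpret P: prob_space ?P by (rule prob_space_sampling_dist)
  have fin: "finite J" using J finite_subset by blast
  have ee: "ip e e = 1" using e by (simp add: Q_ip)
  define p where "p = (1 - \<eta>) * exp (- (s\<^sup>2 / 2 + s * K))"
  have A: "measure (N ?\<mu>) (- ?A) \<le> \<eta>"
  proof -
    have "measure (N ?\<mu>) (- ?A) = measure (N 0) {z. z + ?\<mu> \<in> - ?A}"
      by (rule measure_N_translate) measurable
    also have "\<dots> \<le> measure (N 0) (- {z. \<bar>ip e z\<bar> \<le> K})"
      by (intro N.finite_measure_mono) (auto simp: ip_linear ee)
    also have "\<dots> = 1 - measure (N 0) {z. \<bar>ip e z\<bar> \<le> K}"
      using N.prob_compl[of "{z. \<bar>ip e z\<bar> \<le> K}" 0] by (simp add: Compl_eq_Diff_UNIV)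
    finally show ?thesis using \<eta> by simp
  qed
  have B: "measure (N 0) (- ?B) ^ (card J - 1) \<le> exp (- (p * real (card J - 1)))"
  proof -
    have "s \<ge> 0" using a K by (simp add: s_def)
    have "p \<le> exp (- (s\<^sup>2 / 2 + s * K)) * measure (N 0) {z. \<bar>ip e z\<bar> \<le> K}"
      using \<eta> by (simp add: p_def mult.commute)
    also have "\<dots> \<le> measure (N 0) {z. s - K \<le> ip e z}"
      by (rule gaussian_tail_lower[OF e \<open>s \<ge> 0\<close>])
    also have "{z. s - K \<le> ip e z} = ?B" by (simp add: s_def algebra_simps)
    also have "measure (N 0) ?B = 1 - measure (N 0) (- ?B)"
      using N.prob_compl[of ?B 0] by (simp add: Compl_eq_Diff_UNIV)
    finally have "measure (N 0) (- ?B) \<le> 1 - p" by simp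
    also have "\<dots> \<le> exp (- p)" using exp_ge_add_one_self[of "- p"] by simp
    finally have "measure (N 0) (- ?B) ^ (card J - 1) \<le> exp (- p) ^ (card J - 1)"
      by (rule power_mono) simp
    then show ?thesis by (simp add: exp_of_nat_mult[symmetric] mult.commute)
  qed
  have E: "1 - \<eta> - exp (- (p * real (card J - 1))) \<le> measure ?P ?E"
    using spike_hidden_probability[where J=J and n=n and j=j and \<theta>=\<theta> and A="?A" and B="?B" and \<mu>="?\<mu>"] J \<theta> A B by simp
  have comp: "(\<lambda>x. x i) \<in> PiM {1..n} (\<lambda>_. borel) \<rightarrow>\<^sub>M (borel :: (real^'k) measure)" if "i \<in> J" for i
    using that J by (intro measurable_component_singleton) auto
  note [measurable] = comp comp[OF J(2)]
  have Es[measurable]: "?E \<in> sets ?P"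
    using fin by measurable
  have c: "0 \<le> a\<^sup>2 * (1 - exp (- a))" using a by simp
  have "ennreal (a\<^sup>2 * ((1 - exp (- a)) * (1 - \<eta> - exp (- (p * real (card J - 1))))))
    \<le> ennreal (a\<^sup>2 * (1 - exp (- a)) * measure ?P ?E)"
    unfolding mult.assoc[symmetric] using E c by (intro ennreal_leI mult_left_mono)
  also have "\<dots> = ennreal (a\<^sup>2 * (1 - exp (- a))) * emeasure ?P ?E"
    using c by (simp add: P.emeasure_eq_measure ennreal_mult')
  also have "\<dots> = (\<integral>\<^sup>+x. ennreal (a\<^sup>2 * (1 - exp (- a))) * indicator ?E x \<partial>?P)"
    by (rule nn_integral_cmult_indicator[symmetric]) (rule Es)
  also have "\<dots> \<le> (\<integral>\<^sup>+x. ennreal (Q ?\<mu> * (1 - lratio ?\<mu> (x j) / (\<Sum>i\<in>J. lratio ?\<mu> (x i)))) \<partial>?P)"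
  proof (rule nn_integral_mono)
    fix x
    have "a\<^sup>2 * (1 - exp (- a)) \<le> Q ?\<mu> * (1 - lratio ?\<mu> (x j) / (\<Sum>i\<in>J. lratio ?\<mu> (x i)))" if x: "x \<in> ?E"
    proof -
      obtain i where i: "i \<in> J" "a + K + 1 \<le> ip e (x i)" using x by auto
      have "lratio ?\<mu> (x j) / (\<Sum>i\<in>J. lratio ?\<mu> (x i)) \<le> lratio ?\<mu> (x j) / lratio ?\<mu> (x i)"
        using i(1) fin lratio_pos
        by (intro divide_left_mono member_le_sum mult_pos_pos sum_pos) (auto intro: less_imp_le)
      also have "\<dots> = exp (a * (ip e (x j) - ip e (x i)))"
        by (simp add: lratio_def exp_diff[symmetric] ip_linear algebra_simps)
      also have "\<dots> \<le> exp (- a)"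
      proof -
        have "a * (ip e (x j) - ip e (x i)) \<le> a * (- 1)"
          using x i a by (intro mult_left_mono) auto
        then show ?thesis by simp
      qed
      finally show ?thesis by (simp add: Q_scaleR e mult_left_mono)
    qed
    then show "ennreal (a\<^sup>2 * (1 - exp (- a))) * indicator ?E x
      \<le> ennreal (Q ?\<mu> * (1 - lratio ?\<mu> (x j) / (\<Sum>i\<in>J. lratio ?\<mu> (x i))))"
      by (simp add: indicator_def ennreal_leI)
  qed
  finally show ?thesis by (simp add: p_def)
qed

end

section \<open>Lower bound: independent blocks\<close>

text \<open>
  Averaging over all choice functions is unchanged if one value is drawn again.  This isolates the
  average over the spike position of a single block.
\<close>
lemma sum_PiE_resample:
  fixes G :: "('i \<Rightarrow> 'a) \<Rightarrow> 'c::comm_semiring_1"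
  assumes b: "b \<in> B"
  shows "(\<Sum>f\<in>Pi\<^sub>E B J. \<Sum>y\<in>J b. G (f(b := y))) = of_nat (card (J b)) * (\<Sum>f\<in>Pi\<^sub>E B J. G f)"
proof -
  define B' where "B' = B - {b}"
  have B: "B = insert b B'" "b \<notin> B'" using b by (auto simp: B'_def)
  have inj: "inj_on (\<lambda>(y, g). g(b := y)) (J b \<times> Pi\<^sub>E B' J)"
    using B(2) by (rule inj_combinator)
  have PiE: "Pi\<^sub>E B J = (\<lambda>(y, g). g(b := y)) ` (J b \<times> Pi\<^sub>E B' J)"
    unfolding B(1) by (rule PiE_insert_eq)
  have *: "(\<Sum>f\<in>Pi\<^sub>E B J. H f) = (\<Sum>y\<in>J b. \<Sum>g\<in>Pi\<^sub>E B' J. H (g(b := y)))" for H :: "('i \<Rightarrow> 'a) \<Rightarrow> 'c"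
    unfolding PiE by (subst sum.reindex[OF inj]) (simp add: sum.cartesian_product case_prod_unfold)
  have "(\<Sum>f\<in>Pi\<^sub>E B J. \<Sum>y\<in>J b. G (f(b := y))) = of_nat (card (J b)) * (\<Sum>g\<in>Pi\<^sub>E B' J. \<Sum>y\<in>J b. G (g(b := y)))"
    unfolding * by simp
  also have "(\<Sum>g\<in>Pi\<^sub>E B' J. \<Sum>y\<in>J b. G (g(b := y))) = (\<Sum>f\<in>Pi\<^sub>E B J. G f)"
    unfolding * by (rule sum.swap)
  finally show ?thesis .
qed

definition spikes :: "nat \<Rightarrow> 'a \<Rightarrow> nat set \<Rightarrow> nat \<Rightarrow> 'a::zero" where
  "spikes n \<mu> A = (\<lambda>i\<in>{1..n}. if i \<in> A then \<mu> else 0)"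

lemma spikes_insert: "y \<in> {1..n} \<Longrightarrow> spikes n \<mu> (insert y A) = (spikes n \<mu> A)(y := \<mu>)"
  by (auto simp: spikes_def fun_eq_iff)

lemma spikes_nearly_black:
  assumes "finite A" "card A \<le> q"
  shows "spikes n \<mu> A \<in> nearly_black n q"
proof -
  have "(\<Sum>i = 1..n. of_bool (spikes n \<mu> A i \<noteq> 0) :: nat) = card {i\<in>{1..n}. spikes n \<mu> A i \<noteq> 0}"
    by (simp add: Int_def)
  also have "\<dots> \<le> card A"
    using assms(1) by (intro card_mono) (auto simp: spikes_def)
  finally show ?thesis
    using assms(2) unfolding nearly_black_def by (auto simp: spikes_def PiE_iff simp del: sum_of_bool_eq)
qed

text \<open>
  The bound of \<open>posterior_spread\<close> for a block of \<open>m\<close> coordinates and a spike of norm \<open>a\<close>, as a function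
  of a real variable \<open>m\<close>, so that limits can be taken along the reals.
\<close>
definition block_bound :: "real \<Rightarrow> real \<Rightarrow> real \<Rightarrow> real \<Rightarrow> real" where
  "block_bound \<eta> K a m = a\<^sup>2 * ((1 - exp (- a)) * (1 - \<eta> - exp (- ((1 - \<eta>)
     * exp (- ((a + 2 * K + 1)\<^sup>2 / 2 + (a + 2 * K + 1) * K)) * (m - 1)))))"

context covariance
begin

text \<open>
  The supremum over nearly black means dominates the average over all ways \<open>f\<close> of choosing one spike
  per block.  In this average, the contribution of block \<open>b\<close> is handled with the other spikes
  held fixed, so that \<open>block_risk_ge_posterior\<close> applies to it.
\<close>
lemma minimax_risk_ge_blocks:
  fixes \<mu> :: "real^'k" and c :: ennreal
  assumes m: "m > 0" and qm: "q * m \<le> n"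
    and c: "\<And>J \<theta> j. \<lbrakk>J \<subseteq> {1..n}; card J = m; j \<in> J; \<And>i. i \<in> J \<Longrightarrow> \<theta> i = 0\<rbrakk> \<Longrightarrow>
      c \<le> (\<integral>\<^sup>+x. ennreal (Q \<mu> * (1 - lratio \<mu> (x j) / (\<Sum>i\<in>J. lratio \<mu> (x i)))) \<partial>sampling_dist n S (\<theta>(j := \<mu>)))"
  shows "of_nat q * c \<le> minimax_risk n q S"
  unfolding minimax_risk_def
proof (rule INF_greatest)
  fix T :: "(nat \<Rightarrow> real^'k) \<Rightarrow> nat \<Rightarrow> real^'k" assume T: "T \<in> estimators n"
  define J where "J b = {b * m + 1..b * m + m}" for b
  have cardJ: "card (J b) = m" and finJ: "finite (J b)" for b by (simp_all add: J_def)
  have Jn: "J b \<subseteq> {1..n}" if "b < q" for b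
  proof -
    have "b * m + m \<le> q * m" using that mult_le_mono1[of "Suc b" q m] by simp
    then show ?thesis using qm by (auto simp: J_def)
  qed
  have "J a \<inter> J b = {}" if "a < b" for a b
  proof -
    have "a * m + m \<le> b * m" using that mult_le_mono1[of "Suc a" b m] by simp
    then show ?thesis by (auto simp: J_def)
  qed
  then have disj: "J a \<inter> J b = {}" if "a \<noteq> b" for a b
    using that by (cases a b rule: linorder_cases) (auto simp: Int_commute)
  have block_eq: "a = b" if "j \<in> J a" "j \<in> J b" for a b j
    using that disj[of a b] by (cases "a = b") auto
  define F where "F = Pi\<^sub>E {..<q} J"
  have finF: "finite F" unfolding F_def by (intro finite_PiE) (auto simp: finJ)
  have "F \<noteq> {}" unfolding F_def using m by (simp add: PiE_eq_empty_iff J_def)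
  then have cardF: "card F > 0" using finF by (simp add: card_gt_0_iff)
  have FJ: "f b \<in> J b" if "f \<in> F" "b < q" for f b using that by (auto simp: F_def)
  define \<theta> where "\<theta> f = spikes n \<mu> (f ` {..<q})" for f :: "nat \<Rightarrow> nat"
  \<comment> \<open>the share of block \<open>b\<close> in the risk at \<open>\<theta> f\<close>\<close>
  define G where "G b f = (\<Sum>j\<in>J b. \<integral>\<^sup>+x. ennreal (Q (T x j - (if j = f b then \<mu> else 0))) \<partial>sampling_dist n S (\<theta> f))" for b f
  have \<theta>_nb: "\<theta> f \<in> nearly_black n q" if "f \<in> F" for f
    unfolding \<theta>_def using card_image_le[of "{..<q}" f] by (intro spikes_nearly_black) auto
  have risk: "(\<Sum>b<q. G b f) \<le> risk n S T (\<theta> f)" if f: "f \<in> F" for f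
  proof -
    have \<theta>j: "\<theta> f j = (if j = f b then \<mu> else 0)" if "b < q" "j \<in> J b" for b j
    proof -
      have "j \<in> f ` {..<q} \<longleftrightarrow> j = f b"
      proof
        assume "j \<in> f ` {..<q}"
        then obtain a where a: "a < q" "j = f a" by auto
        then have "a = b" using block_eq[of j a b] FJ[OF f] that by simp
        then show "j = f b" using a by simp
      qed (use that in auto)
      moreover have "j \<in> {1..n}" using Jn[OF that(1)] that(2) by (rule subsetD)
      ultimately show ?thesis unfolding \<theta>_def spikes_def by (simp only: restrict_apply' if_True)
    qed
    have "(\<Sum>b<q. G b f) = (\<Sum>b<q. \<Sum>j\<in>J b. \<integral>\<^sup>+x. ennreal (Q (T x j - \<theta> f j)) \<partial>sampling_dist n S (\<theta> f))"
      unfolding G_def using \<theta>j by (intro sum.cong refl) simp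
    also have "\<dots> = (\<Sum>j\<in>(\<Union>b<q. J b). \<integral>\<^sup>+x. ennreal (Q (T x j - \<theta> f j)) \<partial>sampling_dist n S (\<theta> f))"
      using disj by (intro sum.UNION_disjoint[symmetric]) (auto simp: finJ)
    also have "\<dots> \<le> risk n S T (\<theta> f)"
      unfolding risk_def using Jn by (intro sum_mono2) auto
    finally show ?thesis .
  qed
  have G: "of_nat m * c \<le> (\<Sum>y\<in>J b. G b (f(b := y)))" if f: "f \<in> F" and b: "b < q" for f b
  proof -
    \<comment> \<open>the mean without the spike of block \<open>b\<close>\<close>
    define \<theta>' where "\<theta>' = spikes n \<mu> (f ` ({..<q} - {b}))"
    have \<theta>'0: "\<theta>' i = 0" if "i \<in> J b" for i
    proof -
      have "i \<notin> f ` ({..<q} - {b})" 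
      proof
        assume "i \<in> f ` ({..<q} - {b})"
        then obtain a where a: "a < q" "a \<noteq> b" "i = f a" by auto
        then show False using block_eq[OF _ that, of a] FJ[OF f a(1)] by simp
      qed
      moreover have "i \<in> {1..n}" using Jn[OF b] that by (rule subsetD)
      ultimately show ?thesis unfolding \<theta>'_def spikes_def by (simp only: restrict_apply' if_False)
    qed
    have \<theta>y: "\<theta> (f(b := y)) = \<theta>'(y := \<mu>)" if "y \<in> J b" for y
    proof -
      have "{..<q} = insert b ({..<q} - {b})" using b by auto
      then have "(f(b := y)) ` {..<q} = (f(b := y)) ` insert b ({..<q} - {b})" by simp
      also have "\<dots> = insert y ((f(b := y)) ` ({..<q} - {b}))" by (simp only: image_insert fun_upd_same)
      also have "(f(b := y)) ` ({..<q} - {b}) = f ` ({..<q} - {b})" by (rule image_cong) auto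
      finally have "\<theta> (f(b := y)) = spikes n \<mu> (insert y (f ` ({..<q} - {b})))"
        unfolding \<theta>_def by (rule arg_cong)
      also have "\<dots> = \<theta>'(y := \<mu>)"
        unfolding \<theta>'_def using Jn[OF b] that by (intro spikes_insert) (rule subsetD)
      finally show ?thesis .
    qed
    have "of_nat m * c = (\<Sum>j\<in>J b. c)" by (simp add: cardJ)
    also have "\<dots> \<le> (\<Sum>j\<in>J b. \<integral>\<^sup>+x. ennreal (Q \<mu> * (1 - lratio \<mu> (x j) / (\<Sum>i\<in>J b. lratio \<mu> (x i)))) \<partial>sampling_dist n S (\<theta>'(j := \<mu>)))"
    proof (rule sum_mono)
      fix j assume "j \<in> J b"
      then show "c \<le> (\<integral>\<^sup>+x. ennreal (Q \<mu> * (1 - lratio \<mu> (x j) / (\<Sum>i\<in>J b. lratio \<mu> (x i)))) \<partial>sampling_dist n S (\<theta>'(j := \<mu>)))"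
        by (rule c[OF Jn[OF b] cardJ _ \<theta>'0])
    qed
    also have "\<dots> \<le> (\<Sum>y\<in>J b. \<Sum>j\<in>J b. \<integral>\<^sup>+x. ennreal (Q (T x j - (if j = y then \<mu> else 0))) \<partial>sampling_dist n S (\<theta>'(y := \<mu>)))"
      by (rule block_risk_ge_posterior[OF Jn[OF b] \<theta>'0 T])
    also have "\<dots> = (\<Sum>y\<in>J b. G b (f(b := y)))"
      unfolding G_def
    proof (rule sum.cong[OF refl], rule sum.cong[OF refl])
      fix y j assume "y \<in> J b"
      then show "(\<integral>\<^sup>+x. ennreal (Q (T x j - (if j = y then \<mu> else 0))) \<partial>sampling_dist n S (\<theta>'(y := \<mu>)))
        = (\<integral>\<^sup>+x. ennreal (Q (T x j - (if j = (f(b := y)) b then \<mu> else 0))) \<partial>sampling_dist n S (\<theta> (f(b := y))))"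
        by (simp only: \<theta>y fun_upd_same)
    qed
    finally show ?thesis .
  qed
  have GF: "of_nat (card F) * c \<le> (\<Sum>f\<in>F. G b f)" if b: "b < q" for b
  proof -
    have "of_nat m * (of_nat (card F) * c) = (\<Sum>f\<in>F. of_nat m * c)"
      by (simp add: mult_ac)
    also have "\<dots> \<le> (\<Sum>f\<in>F. \<Sum>y\<in>J b. G b (f(b := y)))" using b by (intro sum_mono G)
    also have "\<dots> = of_nat m * (\<Sum>f\<in>F. G b f)"
      unfolding F_def using b by (subst sum_PiE_resample) (simp_all add: cardJ)
    finally show ?thesis
      using m by (subst (asm) ennreal_mult_le_mult_iff) (auto simp: ennreal_of_nat_neq_top)
  qed
  have "of_nat (card F) * (of_nat q * c) = (\<Sum>b<q. of_nat (card F) * c)"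
    by (simp add: mult_ac)
  also have "\<dots> \<le> (\<Sum>b<q. \<Sum>f\<in>F. G b f)" by (intro sum_mono GF) simp
  also have "\<dots> = (\<Sum>f\<in>F. \<Sum>b<q. G b f)" by (rule sum.swap)
  also have "\<dots> \<le> (\<Sum>f\<in>F. SUP \<theta>\<in>nearly_black n q. risk n S T \<theta>)"
  proof (rule sum_mono)
    fix f assume f: "f \<in> F"
    have "risk n S T (\<theta> f) \<le> (SUP \<theta>\<in>nearly_black n q. risk n S T \<theta>)"
      by (rule SUP_upper) (rule \<theta>_nb[OF f])
    then show "(\<Sum>b<q. G b f) \<le> (SUP \<theta>\<in>nearly_black n q. risk n S T \<theta>)"
      using risk[OF f] by (rule order_trans[rotated])
  qed
  also have "\<dots> = of_nat (card F) * (SUP \<theta>\<in>nearly_black n q. risk n S T \<theta>)" by simp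
  finally show "of_nat q * c \<le> (SUP \<theta>\<in>nearly_black n q. risk n S T \<theta>)"
    using cardF by (subst (asm) ennreal_mult_le_mult_iff) (auto simp: ennreal_of_nat_neq_top)
qed

lemma ex_unit_vector: obtains e where "Q e = 1"
proof -
  define x :: "real^'k" where "x = vec 1"
  have x: "x \<noteq> 0" by (simp add: x_def vec_eq_iff)
  show thesis
    by (rule that[of "(1 / sqrt (Q x)) *\<^sub>R x"]) (use Q_pos[OF x] in \<open>simp add: Q_scaleR power_divide\<close>)
qed

proposition minimax_risk_lower:
  assumes \<eta>: "0 < \<eta>" "\<eta> < 1"
  obtains K where "K \<ge> 0" "\<And>n q a. \<lbrakk>0 < q; q \<le> n; a > 0\<rbrakk> \<Longrightarrow>
    ennreal (real q * block_bound \<eta> K a (real (n div q))) \<le> minimax_risk n q S"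
proof -
  obtain e where e: "Q e = 1" by (rule ex_unit_vector)
  obtain K where K: "K \<ge> 0" "measure (N 0) {z. \<bar>ip e z\<bar> \<le> K} \<ge> 1 - \<eta>"
    using gaussian_tight[OF \<eta>(1)] by blast
  show thesis
  proof (rule that[OF K(1)])
    fix n q :: nat and a :: real assume q: "0 < q" "q \<le> n" and a: "a > 0"
    define m where "m = n div q"
    have m: "m > 0" using q by (simp add: m_def div_greater_zero_iff)
    have "of_nat q * ennreal (block_bound \<eta> K a (real m)) \<le> minimax_risk n q S"
    proof (rule minimax_risk_ge_blocks[OF m, where \<mu>="a *\<^sub>R e"])
      show "q * m \<le> n" by (simp add: m_def)
      fix J \<theta> j assume J: "J \<subseteq> {1..n}" "card J = m" "j \<in> J" "\<And>i. i \<in> J \<Longrightarrow> \<theta> i = (0::real^'k)"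
      have "real (card J - 1) = real m - 1" using J m by simp
      then show "ennreal (block_bound \<eta> K a (real m)) \<le> (\<integral>\<^sup>+x. ennreal (Q (a *\<^sub>R e) * (1 - lratio (a *\<^sub>R e) (x j) / (\<Sum>i\<in>J. lratio (a *\<^sub>R e) (x i)))) \<partial>sampling_dist n S (\<theta>(j := a *\<^sub>R e)))"
        using posterior_spread[OF J(1,3,4) e a K \<eta>(2)] by (simp add: block_bound_def)
    qed
    then show "ennreal (real q * block_bound \<eta> K a (real (n div q))) \<le> minimax_risk n q S"
      by (simp add: m_def ennreal_mult'' ennreal_mult' ennreal_of_nat_eq_real_of_nat)
  qed
qed

end

section \<open>Asymptotics of the block bound\<close>

lemma linear_minus_sqrt_at_top:
  fixes \<eta> c d :: real
  assumes "0 < \<eta>" "0 < c"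
  shows "filterlim (\<lambda>x. \<eta> * x - c * sqrt x - d) at_top at_top"
  using assms by real_asymp

context
  fixes \<eta> K :: real
  assumes \<eta>: "0 < \<eta>" "\<eta> < 1" and K: "K \<ge> 0"
begin

text \<open>
  The spike norm \<open>amp m\<close> is just below \<open>sqrt (2 ln m)\<close>, the size of the largest of \<open>m\<close> noise
  components; \<open>rate m\<close> is the exponent in \<open>block_bound\<close> for this norm.
\<close>
private definition amp :: "real \<Rightarrow> real" where "amp m = sqrt (2 * (1 - \<eta>) * ln m)"

private definition rate :: "real \<Rightarrow> real" where
  "rate m = (1 - \<eta>) * exp (- ((amp m + 2 * K + 1)\<^sup>2 / 2 + (amp m + 2 * K + 1) * K)) * (m - 1)"

private lemma amp_at_top: "filterlim amp at_top at_top"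
proof -
  have "filterlim (\<lambda>m::real. sqrt (2 * \<delta> * ln m)) at_top at_top" if "\<delta> > 0" for \<delta>
    using that by real_asymp
  from this[of "1 - \<eta>"] \<eta> show ?thesis by (simp add: amp_def[abs_def])
qed

private lemma amp_sq: "m \<ge> 1 \<Longrightarrow> (amp m)\<^sup>2 = 2 * (1 - \<eta>) * ln m"
  using \<eta> by (simp add: amp_def)

text \<open>
  This is where the spike size matters: the quadratic exponent is \<open>(1 - \<eta>) ln m\<close> up to terms of
  order \<open>sqrt (ln m)\<close>, so that the expected number of noise coordinates above the level, at least
  \<open>rate m\<close>, still grows like a power of \<open>m\<close> up to those terms.
\<close>
private lemma rate_at_top: "filterlim rate at_top at_top"
proof -
  define d where "d = (2 * K + 1)\<^sup>2 / 2 + (2 * K + 1) * K"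
  define h where "h m = \<eta> * ln m - (3 * K + 1) * amp m - d" for m
  have "filterlim (\<lambda>m. \<eta> * ln m - ((3 * K + 1) * sqrt (2 * (1 - \<eta>))) * sqrt (ln m) - d) at_top at_top"
    by (rule filterlim_compose[OF linear_minus_sqrt_at_top ln_at_top]) (use \<eta> K in auto)
  then have h: "filterlim h at_top at_top"
    by (simp add: h_def[abs_def] amp_def real_sqrt_mult mult.assoc)
  have "filterlim (\<lambda>m. ((1 - \<eta>) * ((m - 1) / m)) * exp (h m)) at_top at_top"
  proof (rule filterlim_tendsto_pos_mult_at_top)
    have "((\<lambda>m::real. (m - 1) / m) \<longlongrightarrow> 1) at_top" by real_asymp
    then show "((\<lambda>m. (1 - \<eta>) * ((m - 1) / m)) \<longlongrightarrow> (1 - \<eta>) * 1) at_top"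
      by (intro tendsto_intros)
    show "filterlim (\<lambda>m. exp (h m)) at_top at_top"
      by (rule filterlim_compose[OF exp_at_top h])
  qed (use \<eta> in simp)
  moreover have "\<forall>\<^sub>F m in at_top. ((1 - \<eta>) * ((m - 1) / m)) * exp (h m) = rate m"
    using eventually_ge_at_top[of 1]
  proof eventually_elim
    case (elim m)
    have "(amp m + 2 * K + 1)\<^sup>2 / 2 + (amp m + 2 * K + 1) * K = (amp m)\<^sup>2 / 2 + (3 * K + 1) * amp m + d"
      unfolding d_def by algebra
    also have "(amp m)\<^sup>2 / 2 = ln m - \<eta> * ln m"
      using amp_sq[OF elim] by (simp add: algebra_simps)
    finally have "h m = ln m - ((amp m + 2 * K + 1)\<^sup>2 / 2 + (amp m + 2 * K + 1) * K)"
      by (simp add: h_def)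
    then have "exp (h m) = exp (ln m) * exp (- ((amp m + 2 * K + 1)\<^sup>2 / 2 + (amp m + 2 * K + 1) * K))"
      by (simp only: diff_conv_add_uminus exp_add)
    also have "exp (ln m) = m" using elim by simp
    finally show ?case using elim unfolding rate_def by simp
  qed
  ultimately show ?thesis by (rule filterlim_mono_eventually[OF _ order_refl order_refl])
qed

lemma block_bound_tendsto:
  "((\<lambda>m. block_bound \<eta> K (sqrt (2 * (1 - \<eta>) * ln m)) m / (2 * ln m)) \<longlongrightarrow> (1 - \<eta>)\<^sup>2) at_top"
proof -
  have e: "((\<lambda>m. exp (- f m)) \<longlongrightarrow> 0) at_top" if "filterlim f at_top at_top" for f :: "real \<Rightarrow> real"
    by (rule filterlim_compose[OF exp_at_bot]) (use that in \<open>simp add: filterlim_uminus_at_top\<close>)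
  have "((\<lambda>m. (1 - \<eta>) * ((1 - exp (- amp m)) * (1 - \<eta> - exp (- rate m)))) \<longlongrightarrow> (1 - \<eta>) * ((1 - 0) * (1 - \<eta> - 0))) at_top"
    by (intro tendsto_intros e amp_at_top rate_at_top)
  moreover have "\<forall>\<^sub>F m in at_top. (1 - \<eta>) * ((1 - exp (- amp m)) * (1 - \<eta> - exp (- rate m)))
      = block_bound \<eta> K (sqrt (2 * (1 - \<eta>) * ln m)) m / (2 * ln m)"
    using eventually_gt_at_top[of 1]
  proof eventually_elim
    case (elim m)
    have "block_bound \<eta> K (amp m) m = (amp m)\<^sup>2 * ((1 - exp (- amp m)) * (1 - \<eta> - exp (- rate m)))"
      by (simp add: block_bound_def rate_def)
    then have "block_bound \<eta> K (amp m) m / (2 * ln m)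
        = (amp m)\<^sup>2 / (2 * ln m) * ((1 - exp (- amp m)) * (1 - \<eta> - exp (- rate m)))"
      by simp
    also have "(amp m)\<^sup>2 / (2 * ln m) = 1 - \<eta>"
      using elim amp_sq[of m] by simp
    finally show ?case unfolding amp_def by (rule sym)
  qed
  ultimately have "((\<lambda>m. block_bound \<eta> K (sqrt (2 * (1 - \<eta>) * ln m)) m / (2 * ln m))
      \<longlongrightarrow> (1 - \<eta>) * ((1 - 0) * (1 - \<eta> - 0))) at_top"
    by (rule Lim_transform_eventually)
  then show ?thesis by (simp add: power2_eq_square)
qed

end

section \<open>The minimax rate\<close>

lemma filterlim_ratio_at_top:
  fixes q :: "nat \<Rightarrow> nat"
  assumes "\<And>n. n \<ge> 1 \<Longrightarrow> q n > 0" and "(\<lambda>n. real (q n)) \<in> o(\<lambda>n. real n)"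
  shows "filterlim (\<lambda>n. real n / real (q n)) at_top sequentially"
proof -
  have "(\<lambda>n. real (q n) / real n) \<longlonglongrightarrow> 0"
    using assms(2) by (rule smalloD_tendsto)
  moreover have "\<forall>\<^sub>F n in sequentially. 0 < real (q n) / real n"
    using eventually_ge_at_top[of 1] by eventually_elim (simp add: assms(1))
  ultimately have "filterlim (\<lambda>n. inverse (real (q n) / real n)) at_top sequentially"
    by (rule filterlim_inverse_at_top)
  then show ?thesis by simp
qed

lemma real_div_bounds:
  fixes n q :: nat
  assumes "0 < q" "2 * q \<le> n"
  shows "real n / real q \<le> 2 * real (n div q)" "real (n div q) \<le> real n / real q"
proof -
  have "real n / real q - 1 \<le> real (n div q)"
  proof -
    have "real n = real (n div q) * real q + real (n mod q)"
      by (metis div_mult_mod_eq of_nat_add of_nat_mult)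
    moreover have "real (n mod q) \<le> real q" using assms(1) by (simp add: less_imp_le)
    ultimately have "real n \<le> (real (n div q) + 1) * real q" by (simp add: algebra_simps)
    then show ?thesis using assms(1) by (simp add: divide_le_eq diff_le_eq)
  qed
  moreover have "2 \<le> real n / real q"
    using assms by (simp add: le_divide_eq)
  moreover have "x \<le> 2 * y" if "x - 1 \<le> y" "2 \<le> x" for x y :: real
    using that by linarith
  ultimately show "real n / real q \<le> 2 * real (n div q)" by blast
  show "real (n div q) \<le> real n / real q"
    using assms(1) by (simp add: le_divide_eq flip: of_nat_mult)
qed

theorem theorem1:
  fixes S :: "real ^ 'k ^ 'k" and q :: "nat \<Rightarrow> nat"
  assumes "pos_def_matrix S"
    and "\<And>n. n \<ge> 1 \<Longrightarrow> q n > 0"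
    and "(\<lambda>n. real (q n)) \<in> o(\<lambda>n. real n)"
  shows "\<exists>\<epsilon> :: nat \<Rightarrow> real. \<epsilon> \<in> o(\<lambda>_. 1) \<and>
    (\<forall>\<^sub>F n in sequentially.
       minimax_risk n (q n) S =
         ennreal (2 * real (q n) * ln (real n / real (q n)) * (1 + \<epsilon> n)))"
proof -
  interpret covariance S by standard (rule assms(1))
  define L where "L n = ln (real n / real (q n))" for n
  define m where "m n = real (n div q n)" for n
  define r where "r n = enn2real (minimax_risk n (q n) S) / (2 * real (q n) * L n)" for n
  note ratio = filterlim_ratio_at_top[OF assms(2,3)]
  have L: "filterlim L at_top sequentially"
    unfolding L_def[abs_def] by (rule filterlim_compose[OF ln_at_top ratio])
  have L0: "\<forall>\<^sub>F n in sequentially. 0 < L n"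
    using L by (simp add: filterlim_at_top_dense)
  have ratio2: "\<forall>\<^sub>F n in sequentially. 2 \<le> real n / real (q n)"
    using ratio by (simp add: filterlim_at_top)
  have ev: "\<forall>\<^sub>F n in sequentially. 0 < q n \<and> 2 * q n \<le> n \<and> 0 < L n \<and> 2 * m n \<ge> real n / real (q n) \<and> m n \<le> real n / real (q n)"
    using eventually_ge_at_top[of "1::nat"] L0 ratio2
  proof eventually_elim
    case (elim n)
    have q: "0 < q n" using assms(2) elim(1) by blast
    then have "2 * real (q n) \<le> real n" using elim(3) by (simp add: le_divide_eq)
    then have "2 * q n \<le> n" by linarith
    then show ?case using elim(2) q real_div_bounds[OF q] by (simp add: m_def)
  qed
  have m: "filterlim m at_top sequentially"
  proof (rule filterlim_at_top_mono)
    show "filterlim (\<lambda>n. (1 / 2) * (real n / real (q n))) at_top sequentially"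
      by (rule filterlim_tendsto_pos_mult_at_top[OF tendsto_const _ ratio]) simp
    show "\<forall>\<^sub>F n in sequentially. (1 / 2) * (real n / real (q n)) \<le> m n"
      using ev by eventually_elim simp
  qed
  then have m1: "\<forall>\<^sub>F n in sequentially. 1 < m n"
    by (simp add: filterlim_at_top_dense)
  have lnm: "(\<lambda>n. ln (m n) / L n) \<longlonglongrightarrow> 1"
  proof (rule tendsto_sandwich)
    have "(\<lambda>n. 1 - ln 2 / L n) \<longlonglongrightarrow> 1 - 0"
      by (intro tendsto_intros tendsto_divide_0[OF tendsto_const] filterlim_at_top_imp_at_infinity L)
    then show "(\<lambda>n. 1 - ln 2 / L n) \<longlonglongrightarrow> 1" by simp
    show "\<forall>\<^sub>F n in sequentially. 1 - ln 2 / L n \<le> ln (m n) / L n"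
      using ev
    proof eventually_elim
      case (elim n)
      have "ln x - ln 2 \<le> ln y" if "0 < x" "x \<le> 2 * y" for x y :: real
      proof -
        have "ln x \<le> ln (2 * y)" using that by (subst ln_le_cancel_iff) auto
        also have "\<dots> = ln 2 + ln y" using that by (simp add: ln_mult)
        finally show ?thesis by simp
      qed
      then have "L n - ln 2 \<le> ln (m n)" unfolding L_def using elim by simp
      then have "(L n - ln 2) / L n \<le> ln (m n) / L n" using elim by (intro divide_right_mono) auto
      then show ?case using elim by (simp add: diff_divide_distrib)
    qed
    show "\<forall>\<^sub>F n in sequentially. ln (m n) / L n \<le> 1"
      using ev
    proof eventually_elim
      case (elim n)
      have pos: "0 < real n / real (q n)" using elim by simp
      moreover have "0 < m n" using elim pos by linarith
      ultimately have "ln (m n) \<le> L n" unfolding L_def using elim by (subst ln_le_cancel_iff) auto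
      then show ?case using elim by simp
    qed
  qed simp
  \<comment> \<open>the normalised minimax risk \<open>r\<close> is squeezed between sequences with limits \<open>(1 - \<eta>)\<^sup>2\<close> and \<open>(1 + d)\<^sup>2\<close>\<close>
  have upper: "\<exists>C. \<forall>\<^sub>F n in sequentially. minimax_risk n (q n) S < \<infinity> \<and> r n \<le> (1 + d)\<^sup>2 + C / L n" if d: "d > 0" for d
  proof -
    obtain C where C: "\<And>n q. \<lbrakk>0 < q; q < n\<rbrakk> \<Longrightarrow>
        minimax_risk n q S \<le> ennreal (2 * real q * ln (real n / real q) * (1 + d)\<^sup>2 + C * real q)"
      using minimax_risk_upper[OF d] by blast
    \<comment> \<open>\<open>max C 0\<close> keeps the bound nonnegative, as the passage from extended to real values requires\<close>
    have "\<forall>\<^sub>F n in sequentially. minimax_risk n (q n) S < \<infinity> \<and> r n \<le> (1 + d)\<^sup>2 + max C 0 / 2 / L n"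
      using ev
    proof eventually_elim
      case (elim n)
      define u where "u = 2 * real (q n) * L n * (1 + d)\<^sup>2 + max C 0 * real (q n)"
      have u: "u \<ge> 0" using elim by (simp add: u_def)
      have "minimax_risk n (q n) S \<le> ennreal (2 * real (q n) * L n * (1 + d)\<^sup>2 + C * real (q n))"
        unfolding L_def using elim by (intro C) auto
      also have "\<dots> \<le> ennreal u"
        unfolding u_def by (intro ennreal_leI add_left_mono mult_right_mono) auto
      finally have le: "minimax_risk n (q n) S \<le> ennreal u" .
      then have "enn2real (minimax_risk n (q n) S) \<le> u"
        using u by (rule enn2real_leI[rotated])
      then have "r n \<le> u / (2 * real (q n) * L n)"
        unfolding r_def using elim by (intro divide_right_mono) auto
      also have "\<dots> = (1 + d)\<^sup>2 + max C 0 / 2 / L n"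
        using elim by (simp add: u_def field_simps)
      finally show ?case using le by (auto intro: le_less_trans)
    qed
    then show ?thesis by blast
  qed
  have finite_risk: "\<forall>\<^sub>F n in sequentially. minimax_risk n (q n) S < \<infinity>"
    using upper[OF zero_less_one] by (auto elim: eventually_mono)
  have lower: "\<exists>g. g \<longlonglongrightarrow> (1 - \<eta>)\<^sup>2 \<and> (\<forall>\<^sub>F n in sequentially. g n \<le> r n)" if \<eta>: "0 < \<eta>" "\<eta> < 1" for \<eta>
  proof -
    obtain K where K: "K \<ge> 0" "\<And>n q a. \<lbrakk>0 < q; q \<le> n; a > 0\<rbrakk> \<Longrightarrow>
        ennreal (real q * block_bound \<eta> K a (real (n div q))) \<le> minimax_risk n q S"
      using minimax_risk_lower[OF \<eta>] by blast
    define amp where "amp n = sqrt (2 * (1 - \<eta>) * ln (m n))" for n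
    define g where "g n = block_bound \<eta> K (amp n) (m n) / (2 * ln (m n)) * (ln (m n) / L n)" for n
    have "g \<longlonglongrightarrow> (1 - \<eta>)\<^sup>2 * 1"
      unfolding g_def[abs_def] amp_def
      by (intro tendsto_mult lnm filterlim_compose[OF block_bound_tendsto[OF \<eta> K(1)] m])
    moreover have "\<forall>\<^sub>F n in sequentially. g n \<le> r n"
      using ev m1 finite_risk
    proof eventually_elim
      case (elim n)
      have "amp n > 0" using elim \<eta> by (simp add: amp_def)
      then have "ennreal (real (q n) * block_bound \<eta> K (amp n) (m n)) \<le> minimax_risk n (q n) S"
        unfolding m_def using elim by (intro K(2)) auto
      then have "real (q n) * block_bound \<eta> K (amp n) (m n) \<le> enn2real (minimax_risk n (q n) S)"
        using elim by (cases "minimax_risk n (q n) S") (auto simp: ennreal_le_iff)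
      then have "real (q n) * block_bound \<eta> K (amp n) (m n) / (2 * real (q n) * L n) \<le> r n"
        unfolding r_def using elim by (intro divide_right_mono) auto
      then show ?case using elim by (simp add: g_def)
    qed
    ultimately show ?thesis by auto
  qed
  have r: "r \<longlonglongrightarrow> 1"
  proof (rule order_tendstoI)
    fix y :: real assume y: "y < 1"
    have "((\<lambda>\<eta>. (1 - \<eta>)\<^sup>2) \<longlongrightarrow> (1 - 0 :: real)\<^sup>2) (at_right 0)" by (intro tendsto_intros)
    then have "\<forall>\<^sub>F \<eta> in at_right 0. y < (1 - \<eta>)\<^sup>2" using y by (intro order_tendstoD) auto
    moreover have "\<forall>\<^sub>F \<eta> in at_right (0::real). 0 < \<eta> \<and> \<eta> < 1"
      by (auto simp: eventually_at_right_field intro!: exI[of _ 1])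
    ultimately have "\<forall>\<^sub>F \<eta> in at_right 0. 0 < \<eta> \<and> \<eta> < 1 \<and> y < (1 - \<eta>)\<^sup>2"
      by eventually_elim simp
    then obtain \<eta> where \<eta>: "0 < \<eta>" "\<eta> < 1" "y < (1 - \<eta>)\<^sup>2"
      using eventually_happens'[of "at_right (0::real)"] by auto
    obtain g where g: "g \<longlonglongrightarrow> (1 - \<eta>)\<^sup>2" "\<forall>\<^sub>F n in sequentially. g n \<le> r n"
      using lower[OF \<eta>(1,2)] by blast
    show "\<forall>\<^sub>F n in sequentially. y < r n"
      using g(2) order_tendstoD(1)[OF g(1) \<eta>(3)] by eventually_elim simp
  next
    fix y :: real assume y: "1 < y"
    have "((\<lambda>d. (1 + d)\<^sup>2) \<longlongrightarrow> (1 + 0 :: real)\<^sup>2) (at_right 0)" by (intro tendsto_intros)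
    then have "\<forall>\<^sub>F d in at_right 0. (1 + d)\<^sup>2 < y" using y by (intro order_tendstoD) auto
    moreover have "\<forall>\<^sub>F d in at_right (0::real). 0 < d"
      by (auto simp: eventually_at_right_field intro!: exI[of _ 1])
    ultimately have "\<forall>\<^sub>F d in at_right 0. 0 < d \<and> (1 + d)\<^sup>2 < y"
      by eventually_elim simp
    then obtain d where d: "0 < d" "(1 + d)\<^sup>2 < y"
      using eventually_happens'[of "at_right (0::real)"] by auto
    obtain C where C: "\<forall>\<^sub>F n in sequentially. minimax_risk n (q n) S < \<infinity> \<and> r n \<le> (1 + d)\<^sup>2 + C / L n"
      using upper[OF d(1)] by blast
    have "(\<lambda>n. (1 + d)\<^sup>2 + C / L n) \<longlonglongrightarrow> (1 + d)\<^sup>2 + 0"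
      by (intro tendsto_intros tendsto_divide_0[OF tendsto_const] filterlim_at_top_imp_at_infinity L)
    then have "\<forall>\<^sub>F n in sequentially. (1 + d)\<^sup>2 + C / L n < y" using d(2) by (intro order_tendstoD) auto
    with C show "\<forall>\<^sub>F n in sequentially. r n < y" by eventually_elim simp
  qed
  define \<epsilon> where "\<epsilon> n = r n - 1" for n
  have "\<epsilon> \<longlonglongrightarrow> 0"
    unfolding \<epsilon>_def[abs_def] using tendsto_diff[OF r tendsto_const[of 1]] by simp
  then have "\<epsilon> \<in> o(\<lambda>_. 1)"
    by (intro smalloI_tendsto) auto
  moreover have "\<forall>\<^sub>F n in sequentially. minimax_risk n (q n) S = ennreal (2 * real (q n) * L n * (1 + \<epsilon> n))"
    using ev finite_risk by eventually_elim (simp add: \<epsilon>_def r_def)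
  ultimately show ?thesis unfolding L_def by blast
qed

end
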